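(* Let $\mathcal{A}=(\mathcal{H},Act,\{\mathcal{E}_\alpha\}_{\alpha\in Act},\sigma_0)$ be a quantum automaton with $|Act|>1$ and rational data, and let $\phi=\bigvee_{i=1}^n p_i$ with each $p_i$ a subspace (projection) of $\mathcal{H}$. Then it is decidable whether $\square\phi$ is valid, i.e. whether for every infinite word $\alpha_1\alpha_2\cdots\in Act^\omega$ the induced sequence satisfies $\sigma_k\models\phi$ for all $k\ge0$.
   Context: A quantum automaton consists of a $d$-dimensional Hilbert space $\mathcal{H}$, a finite set $Act$ of actions, a trace-preserving super-operator $\mathcal{E}_\alpha$ on $\mathcal{H}$ for each $\alpha\in Act$, and an initial state $\sigma_0$; all entries are rational. Each word $\alpha_1\alpha_2\cdots\in Act^\omega$ induces the admissible sequence $\sigma_0\sigma_1\sigma_2\cdots$ with $\sigma_i=\mathcal{E}_{\alpha_i}(\sigma_{i-1})$. For a state $\sigma$ and subspace $p$, $\sigma\models p$ iff $\mathrm{supp}(\sigma)\subseteq p$; for a finite union $\phi=\bigvee_i p_i$ of subspaces, $\sigma\models\phi$ iff $\sigma\models p_i$ for some $i$. *)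

theory Defs
  imports
    "Jordan_Normal_Form.Char_Poly"
    "Jordan_Normal_Form.Schur_Decomposition"
    "Jordan_Normal_Form.VS_Connect"
    "HOL-Library.Nat_Bijection"
begin

section \<open>Partial recursive functions\<close>

text \<open>
  An \<open>n\<close>-ary partial function on the naturals is a function \<open>nat list \<Rightarrow> nat option\<close>, of which
  only the values at lists of length \<open>n\<close> matter; \<open>None\<close> means undefined.
\<close>

definition pcomp :: "(nat list \<Rightarrow> nat option) \<Rightarrow> (nat list \<Rightarrow> nat option) list \<Rightarrow> nat list \<Rightarrow> nat option"
  where "pcomp f gs xs =
    (if \<forall>g\<in>set gs. g xs \<noteq> None then f (map (\<lambda>g. the (g xs)) gs) else None)"

primrec pprec :: "(nat list \<Rightarrow> nat option) \<Rightarrow> (nat list \<Rightarrow> nat option) \<Rightarrow> nat \<Rightarrow> nat list \<Rightarrow> nat option"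
  where
    "pprec f g 0 xs = f xs"
  | "pprec f g (Suc k) xs = Option.bind (pprec f g k xs) (\<lambda>r. g (k # r # xs))"

definition pmin_at :: "(nat list \<Rightarrow> nat option) \<Rightarrow> nat list \<Rightarrow> nat \<Rightarrow> bool"
  where "pmin_at f xs y \<longleftrightarrow>
    f (y # xs) = Some 0 \<and> (\<forall>z<y. \<exists>v. f (z # xs) = Some v \<and> v \<noteq> 0)"

definition pmin :: "(nat list \<Rightarrow> nat option) \<Rightarrow> nat list \<Rightarrow> nat option"
  where "pmin f xs = (if \<exists>y. pmin_at f xs y then Some (THE y. pmin_at f xs y) else None)"

inductive partial_recursive :: "nat \<Rightarrow> (nat list \<Rightarrow> nat option) \<Rightarrow> bool"
  where
    zero: "partial_recursive n (\<lambda>xs. Some 0)"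
  | succ: "partial_recursive 1 (\<lambda>xs. Some (Suc (xs ! 0)))"
  | proj: "i < n \<Longrightarrow> partial_recursive n (\<lambda>xs. Some (xs ! i))"
  | comp: "partial_recursive (length gs) f \<Longrightarrow> (\<And>g. g \<in> set gs \<Longrightarrow> partial_recursive n g)
      \<Longrightarrow> partial_recursive n (pcomp f gs)"
  | prec: "partial_recursive n f \<Longrightarrow> partial_recursive (n + 2) g
      \<Longrightarrow> partial_recursive (n + 1) (\<lambda>xs. pprec f g (hd xs) (tl xs))"
  | min: "partial_recursive (n + 1) f \<Longrightarrow> partial_recursive n (pmin f)"
  | ext: "partial_recursive n f \<Longrightarrow> (\<And>xs. length xs = n \<Longrightarrow> g xs = f xs)
      \<Longrightarrow> partial_recursive n g"


section \<open>States, supports and super-operators on a \<open>d\<close>-dimensional Hilbert space\<close>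

definition mtrace :: "complex mat \<Rightarrow> complex"
  where "mtrace M = (\<Sum>i<dim_row M. M $$ (i, i))"

text \<open>
  The order on \<^typ>\<open>complex\<close> makes \<open>0 \<le> z\<close> say that \<open>z\<close> is real and nonnegative, so a positive
  matrix is in particular Hermitian.
\<close>

definition positive :: "nat \<Rightarrow> complex mat \<Rightarrow> bool"
  where "positive d M \<longleftrightarrow>
    M \<in> carrier_mat d d \<and> (\<forall>v\<in>carrier_vec d. 0 \<le> (M *\<^sub>v v) \<bullet>c v)"

definition density :: "nat \<Rightarrow> complex mat \<Rightarrow> bool"
  where "density d \<sigma> \<longleftrightarrow> positive d \<sigma> \<and> mtrace \<sigma> = 1"

definition supp :: "complex mat \<Rightarrow> complex vec set"
  where "supp \<sigma> = LinearCombinations.module.span class_ring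
    (module_vec TYPE(complex) (dim_row \<sigma>)) {v. \<exists>e. e \<noteq> 0 \<and> eigenvector \<sigma> v e}"

definition is_subspace :: "nat \<Rightarrow> complex vec set \<Rightarrow> bool"
  where "is_subspace d p \<longleftrightarrow> VectorSpace.subspace class_ring p (module_vec TYPE(complex) d)"

definition projector_onto :: "nat \<Rightarrow> complex mat \<Rightarrow> complex vec set \<Rightarrow> bool"
  where "projector_onto d P p \<longleftrightarrow>
    P \<in> carrier_mat d d \<and> mat_adjoint P = P \<and> P * P = P \<and> p = (\<lambda>v. P *\<^sub>v v) ` carrier_vec d"

definition block :: "nat \<Rightarrow> complex mat \<Rightarrow> nat \<Rightarrow> nat \<Rightarrow> complex mat"
  where "block d X a b = mat d d (\<lambda>(i, j). X $$ (a * d + i, b * d + j))"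

text \<open>The map \<open>id \<otimes> E\<close> on the operators of the \<open>k * d\<close>-dimensional tensor product: it applies \<open>E\<close>
  to each of the \<open>k * k\<close> blocks of size \<open>d * d\<close>.\<close>

definition ampliation :: "nat \<Rightarrow> nat \<Rightarrow> (complex mat \<Rightarrow> complex mat) \<Rightarrow> complex mat \<Rightarrow> complex mat"
  where "ampliation k d E X =
    mat (k * d) (k * d) (\<lambda>(i, j). E (block d X (i div d) (j div d)) $$ (i mod d, j mod d))"

definition linear_superop :: "nat \<Rightarrow> (complex mat \<Rightarrow> complex mat) \<Rightarrow> bool"
  where "linear_superop d E \<longleftrightarrow>
    (\<forall>A\<in>carrier_mat d d. E A \<in> carrier_mat d d) \<and>
    (\<forall>A\<in>carrier_mat d d. \<forall>B\<in>carrier_mat d d. E (A + B) = E A + E B) \<and>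
    (\<forall>c. \<forall>A\<in>carrier_mat d d. E (c \<cdot>\<^sub>m A) = c \<cdot>\<^sub>m E A)"

definition completely_positive :: "nat \<Rightarrow> (complex mat \<Rightarrow> complex mat) \<Rightarrow> bool"
  where "completely_positive d E \<longleftrightarrow>
    (\<forall>k X. positive (k * d) X \<longrightarrow> positive (k * d) (ampliation k d E X))"

definition trace_preserving :: "nat \<Rightarrow> (complex mat \<Rightarrow> complex mat) \<Rightarrow> bool"
  where "trace_preserving d E \<longleftrightarrow> (\<forall>A\<in>carrier_mat d d. mtrace (E A) = mtrace A)"

definition tp_superoperator :: "nat \<Rightarrow> (complex mat \<Rightarrow> complex mat) \<Rightarrow> bool"
  where "tp_superoperator d E \<longleftrightarrow>
    linear_superop d E \<and> completely_positive d E \<and> trace_preserving d E"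

definition matrix_unit :: "nat \<Rightarrow> nat \<Rightarrow> nat \<Rightarrow> complex mat"
  where "matrix_unit d i j = mat d d (\<lambda>(k, l). if k = i \<and> l = j then 1 else 0)"

text \<open>
  The matrix of \<open>E\<close> with respect to the matrix units, with rows and columns indexed by pairs in
  row-major order. If \<open>E\<close> has Kraus operators \<open>K\<^sub>1, K\<^sub>2, \<dots>\<close>, it is the sum of the Kronecker products
  of \<open>K\<^sub>i\<close> with its entrywise conjugate.
\<close>

definition superop_mat :: "nat \<Rightarrow> (complex mat \<Rightarrow> complex mat) \<Rightarrow> complex mat"
  where "superop_mat d E = mat (d * d) (d * d)
    (\<lambda>(r, c). E (matrix_unit d (c div d) (c mod d)) $$ (r div d, r mod d))"


section \<open>Quantum automata\<close>

record 'a quantum_automaton =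
  hdim :: nat
  Act :: "'a set"
  superop :: "'a \<Rightarrow> complex mat \<Rightarrow> complex mat"
  init :: "complex mat"

definition quantum_automaton :: "'a quantum_automaton \<Rightarrow> bool"
  where "quantum_automaton A \<longleftrightarrow>
    finite (Act A) \<and>
    (\<forall>\<alpha>\<in>Act A. tp_superoperator (hdim A) (superop A \<alpha>)) \<and>
    density (hdim A) (init A)"

text \<open>A word \<open>w\<close> is indexed from 0: its first letter, leading from \<open>\<sigma>\<^sub>0\<close> to \<open>\<sigma>\<^sub>1\<close>, is \<open>w 0\<close>.\<close>

primrec admissible :: "'a quantum_automaton \<Rightarrow> (nat \<Rightarrow> 'a) \<Rightarrow> nat \<Rightarrow> complex mat"
  where
    "admissible A w 0 = init A"
  | "admissible A w (Suc k) = superop A (w k) (admissible A w k)"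

definition sat_subspace :: "complex mat \<Rightarrow> complex vec set \<Rightarrow> bool"
  where "sat_subspace \<sigma> p \<longleftrightarrow> supp \<sigma> \<subseteq> p"

definition sat_union :: "complex mat \<Rightarrow> complex vec set list \<Rightarrow> bool"
  where "sat_union \<sigma> ps \<longleftrightarrow> (\<exists>p\<in>set ps. sat_subspace \<sigma> p)"

definition box_valid :: "'a quantum_automaton \<Rightarrow> complex vec set list \<Rightarrow> bool"
  where "box_valid A ps \<longleftrightarrow>
    (\<forall>w. (\<forall>k. w k \<in> Act A) \<longrightarrow> (\<forall>k. sat_union (admissible A w k) ps))"


section \<open>Rational data and its encoding by natural numbers\<close>

text \<open>A pair \<open>(a, b)\<close> of rationals stands for the complex number \<open>a + b \<i>\<close>.\<close>

definition gauss_rat :: "rat \<times> rat \<Rightarrow> complex"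
  where "gauss_rat q = Complex (of_rat (fst q)) (of_rat (snd q))"

record rational_data =
  rdim :: nat
  rsuperops :: "(rat \<times> rat) mat list"
  rinit :: "(rat \<times> rat) mat"
  rprojs :: "(rat \<times> rat) mat list"

definition presents :: "rational_data \<Rightarrow> 'a quantum_automaton \<Rightarrow> complex vec set list \<Rightarrow> bool"
  where "presents c A ps \<longleftrightarrow>
    rdim c = hdim A \<and>
    (\<exists>as. distinct as \<and> set as = Act A \<and>
      map (map_mat gauss_rat) (rsuperops c) = map (\<lambda>\<alpha>. superop_mat (hdim A) (superop A \<alpha>)) as) \<and>
    map_mat gauss_rat (rinit c) = init A \<and>
    list_all2 (projector_onto (hdim A)) (map (map_mat gauss_rat) (rprojs c)) ps"

definition encode_rat :: "rat \<Rightarrow> nat"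
  where "encode_rat q =
    prod_encode (int_encode (fst (quotient_of q)), int_encode (snd (quotient_of q)))"

definition encode_mat :: "(rat \<times> rat) mat \<Rightarrow> nat"
  where "encode_mat M = list_encode
    (map (list_encode \<circ> map (\<lambda>(a, b). prod_encode (encode_rat a, encode_rat b))) (mat_to_list M))"

definition encode_data :: "rational_data \<Rightarrow> nat"
  where "encode_data c = list_encode
    [rdim c, list_encode (map encode_mat (rsuperops c)), encode_mat (rinit c),
     list_encode (map encode_mat (rprojs c))]"

end

theory Submission
  imports Defs "HOL-Library.Function_Algebras"
begin

text \<open>
  For a positive matrix \<open>\<sigma>\<close> and the projector \<open>P\<close> onto \<open>p\<close>, the support of \<open>\<sigma>\<close> lies in \<open>p\<close> iff
  \<open>P * \<sigma> = \<sigma>\<close>. So satisfying one of \<open>n\<close> subspaces amounts to satisfying one of \<open>n\<close> systems of linear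
  equations, which is a system of linear equations for the \<open>n\<close>-th tensor power of the state.
  Along a shortest word leading to a violation, the tensor power of each state is separated by a
  linear functional from those of all earlier states, since skipping the letters in between
  gives a shorter word. These tensor powers are thus linearly independent, and the word is shorter
  than \<open>(d * d) ^ n\<close>. It remains to simulate all words up to this length with Gaussian rationals, which
  is a recursive procedure.
\<close>

section \<open>Total recursive functions\<close>

text \<open>Two obstacles shape the proof. The support is defined through eigenvectors for nonzero
  eigenvalues, so passing from the inclusion to \<open>P * \<sigma> = \<sigma>\<close> needs
  eigenvectors that span the whole space. They come from a Schur triangulation: its columns turn out
  to be sums of eigenvectors, because a positive matrix has no Jordan chain of length two. A union
  of subspaces is not cut out by linear equations in the state. A violation breaks one equation for
  every subspace at once; the product of these \<open>n\<close> functionals is a single linear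
  functional on the tensor power, nonzero exactly when every factor is. Each factor is pulled back
  along the remaining word, which acts linearly on the \<open>d * d\<close> entries. Tensor powers
  occur only as scalar functions on index tuples. Recursiveness is handled by a typed layer,
  \<open>computable\<close>, with closure rules for functions on nested pairs and lists. Its codes
  agree with those used for the matrices of the presentation, so the procedure is written as a
  functional program and proved computable by following its syntax.\<close>

definition total_recursive :: "nat \<Rightarrow> (nat list \<Rightarrow> nat) \<Rightarrow> bool"
  where "total_recursive n f \<longleftrightarrow> partial_recursive n (\<lambda>xs. Some (f xs))"

lemma total_recursive_cong:
  assumes "total_recursive n f" and "\<And>xs. length xs = n \<Longrightarrow> g xs = f xs"
  shows "total_recursive n g"
  using assms unfolding total_recursive_def by (auto intro: partial_recursive.ext)

lemma total_recursive_zero: "total_recursive n (\<lambda>xs. 0)"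
  unfolding total_recursive_def by (rule partial_recursive.zero)

lemma total_recursive_nth: "i < n \<Longrightarrow> total_recursive n (\<lambda>xs. xs ! i)"
  unfolding total_recursive_def by (rule partial_recursive.proj)

lemma total_recursive_comp:
  assumes "total_recursive (length gs) f" and "\<And>g. g \<in> set gs \<Longrightarrow> total_recursive n g"
  shows "total_recursive n (\<lambda>xs. f (map (\<lambda>g. g xs) gs))"
proof -
  have "partial_recursive n (pcomp (\<lambda>xs. Some (f xs)) (map (\<lambda>g xs. Some (g xs)) gs))"
    using assms unfolding total_recursive_def by (intro partial_recursive.comp) auto
  then show ?thesis
    unfolding total_recursive_def
    by (rule partial_recursive.ext) (auto simp: pcomp_def comp_def)
qed

lemma total_recursive_comp1:
  assumes "total_recursive 1 (\<lambda>xs. f (xs ! 0))" and "total_recursive n g"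
  shows "total_recursive n (\<lambda>xs. f (g xs))"
  using total_recursive_comp[of "[g]" "\<lambda>xs. f (xs ! 0)" n] assms by simp

lemma total_recursive_comp2:
  assumes "total_recursive 2 (\<lambda>xs. f (xs ! 0) (xs ! 1))"
    and "total_recursive n g" and "total_recursive n h"
  shows "total_recursive n (\<lambda>xs. f (g xs) (h xs))"
  using total_recursive_comp[of "[g, h]" "\<lambda>xs. f (xs ! 0) (xs ! 1)" n] assms
  by (auto simp: numeral_2_eq_2)

lemma total_recursive_Suc: "total_recursive n f \<Longrightarrow> total_recursive n (\<lambda>xs. Suc (f xs))"
  by (rule total_recursive_comp1[of Suc])
    (auto simp: total_recursive_def intro: partial_recursive.succ[simplified])

lemma total_recursive_const: "total_recursive n (\<lambda>xs. c)"
  by (induction c) (auto intro: total_recursive_zero total_recursive_Suc)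

lemma total_recursive_prec:
  assumes "total_recursive n f" and "total_recursive (n + 2) g"
  shows "total_recursive (n + 1) (\<lambda>xs. rec_nat (f (tl xs)) (\<lambda>k r. g (k # r # tl xs)) (hd xs))"
proof -
  have "pprec (\<lambda>xs. Some (f xs)) (\<lambda>xs. Some (g xs)) k xs
      = Some (rec_nat (f xs) (\<lambda>k r. g (k # r # xs)) k)" for k xs
    by (induction k) auto
  with partial_recursive.prec[OF assms[unfolded total_recursive_def]] show ?thesis
    unfolding total_recursive_def by simp
qed

lemma total_recursive_rec_nat1:
  assumes "total_recursive 2 (\<lambda>xs. g (xs ! 0) (xs ! 1))" and "total_recursive n h"
  shows "total_recursive n (\<lambda>xs. rec_nat a g (h xs))"
proof -
  have "total_recursive (0 + 1) (\<lambda>xs. rec_nat a (\<lambda>k r. g ((k # r # tl xs) ! 0) ((k # r # tl xs) ! 1)) (hd xs))"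
    using total_recursive_prec[of 0 "\<lambda>_. a" "\<lambda>xs. g (xs ! 0) (xs ! 1)"] assms(1)
    by (simp add: total_recursive_const numeral_2_eq_2)
  then have "total_recursive 1 (\<lambda>xs. rec_nat a g (xs ! 0))"
    unfolding add_0 by (rule total_recursive_cong) (auto simp: length_Suc_conv)
  then show ?thesis
    using assms(2) by (rule total_recursive_comp1)
qed

text \<open>One parameter is enough: \<open>computable_rec_nat\<close> passes its whole context as a
  single code.\<close>

lemma total_recursive_rec_nat2:
  assumes "total_recursive 1 (\<lambda>xs. f (xs ! 0))"
    and "total_recursive 3 (\<lambda>xs. g (xs ! 2) (xs ! 0) (xs ! 1))"
    and "total_recursive n a" and "total_recursive n h"
  shows "total_recursive n (\<lambda>xs. rec_nat (f (a xs)) (g (a xs)) (h xs))"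
proof -
  have "total_recursive (1 + 1) (\<lambda>xs. rec_nat (f (tl xs ! 0))
      (\<lambda>k r. g ((k # r # tl xs) ! 2) ((k # r # tl xs) ! 0) ((k # r # tl xs) ! 1)) (hd xs))"
    using total_recursive_prec[of 1 "\<lambda>xs. f (xs ! 0)" "\<lambda>xs. g (xs ! 2) (xs ! 0) (xs ! 1)"] assms(1,2)
    by (simp add: numeral_3_eq_3)
  then have "total_recursive 2 (\<lambda>xs. rec_nat (f (xs ! 1)) (g (xs ! 1)) (xs ! 0))"
    unfolding one_add_one by (rule total_recursive_cong) (auto simp: length_Suc_conv numeral_2_eq_2)
  then show ?thesis
    using assms(4,3) by (rule total_recursive_comp2)
qed

lemma total_recursive_add:
  assumes "total_recursive n f" and "total_recursive n g"
  shows "total_recursive n (\<lambda>xs. f xs + g xs)"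
proof -
  have "total_recursive n (\<lambda>xs. rec_nat (f xs) ((\<lambda>_ _ r. Suc r) (f xs)) (g xs))"
    by (rule total_recursive_rec_nat2)
      (auto intro!: total_recursive_Suc total_recursive_nth assms)
  moreover have "rec_nat a (\<lambda>_ r. Suc r) b = a + b" for a b :: nat
    by (induction b) auto
  ultimately show ?thesis by simp
qed

lemma total_recursive_mult:
  assumes "total_recursive n f" and "total_recursive n g"
  shows "total_recursive n (\<lambda>xs. f xs * g xs)"
proof -
  have "total_recursive n (\<lambda>xs. rec_nat ((\<lambda>_. 0) (f xs)) ((\<lambda>a _ r. r + a) (f xs)) (g xs))"
    by (rule total_recursive_rec_nat2)
      (auto intro!: total_recursive_add total_recursive_nth total_recursive_const assms)
  moreover have "rec_nat 0 (\<lambda>_ r. r + a) b = a * b" for a b :: nat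
    by (induction b) auto
  ultimately show ?thesis by simp
qed

lemma total_recursive_pred:
  assumes "total_recursive n f"
  shows "total_recursive n (\<lambda>xs. f xs - 1)"
proof -
  have "total_recursive n (\<lambda>xs. rec_nat 0 (\<lambda>k _. k) (f xs))"
    by (rule total_recursive_rec_nat1) (auto intro!: total_recursive_nth assms)
  moreover have "rec_nat 0 (\<lambda>k _. k) b = b - 1" for b :: nat
    by (cases b) auto
  ultimately show ?thesis by simp
qed

lemma total_recursive_diff:
  assumes "total_recursive n f" and "total_recursive n g"
  shows "total_recursive n (\<lambda>xs. f xs - g xs)"
proof -
  have "total_recursive n (\<lambda>xs. rec_nat (f xs) ((\<lambda>_ _ r. r - 1) (f xs)) (g xs))"
    by (rule total_recursive_rec_nat2)
      (auto intro!: total_recursive_pred[simplified] total_recursive_nth assms)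
  moreover have "rec_nat a (\<lambda>_ r. r - 1) b = a - b" for a b :: nat
    by (induction b) auto
  ultimately show ?thesis by simp
qed

section \<open>The Cantor pairing and its inverse\<close>

lemma total_recursive_triangle:
  assumes "total_recursive n f"
  shows "total_recursive n (\<lambda>xs. triangle (f xs))"
proof -
  have "total_recursive n (\<lambda>xs. rec_nat 0 (\<lambda>k r. r + Suc k) (f xs))"
    by (rule total_recursive_rec_nat1)
      (auto intro!: total_recursive_add total_recursive_Suc total_recursive_nth assms)
  moreover have "rec_nat 0 (\<lambda>k r. r + Suc k) b = triangle b" for b :: nat
    by (induction b) auto
  ultimately show ?thesis by simp
qed

lemma total_recursive_prod_encode:
  assumes "total_recursive n f" and "total_recursive n g"
  shows "total_recursive n (\<lambda>xs. prod_encode (f xs, g xs))"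
  unfolding prod_encode_def
  by (auto intro!: total_recursive_add total_recursive_triangle assms)

lemma strict_mono_triangle: "strict_mono triangle"
  by (rule strict_mono_Suc_iff[THEN iffD2]) simp

text \<open>The pair \<open>(a, b)\<close> has code \<open>z = triangle (a + b) + a\<close>, so its
  diagonal \<open>a + b\<close> is the least \<open>y\<close> with
  \<open>z < triangle (Suc y)\<close>. Unbounded search finds it; this is the only use of
  minimisation.\<close>

lemma total_recursive_prod_decode_sum:
  assumes "total_recursive n f"
  shows "total_recursive n (\<lambda>xs. fst (prod_decode (f xs)) + snd (prod_decode (f xs)))"
proof -
  let ?s = "\<lambda>z. fst (prod_decode z) + snd (prod_decode z)"
  \<comment> \<open>The candidate \<open>y\<close> is at position 0 and \<open>z\<close> at position
    1. Subtraction is truncated, so the value is 0 exactly when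
    \<open>z < triangle (Suc y)\<close>.\<close>
  let ?F = "\<lambda>xs. Some (Suc (xs ! 1) - triangle (Suc (xs ! 0)))"
  have "total_recursive (1 + 1) (\<lambda>xs. Suc (xs ! 1) - triangle (Suc (xs ! 0)))"
    by (intro total_recursive_diff total_recursive_Suc total_recursive_triangle total_recursive_nth) auto
  then have pmin: "partial_recursive 1 (pmin ?F)"
    unfolding total_recursive_def by (rule partial_recursive.min)
  have "pmin ?F [z] = Some (?s z)" for z
  proof -
    obtain a b where ab: "prod_decode z = (a, b)" by fastforce
    then have z: "z = triangle (a + b) + a"
      using prod_decode_inverse[of z] by (simp add: prod_encode_def)
    have "pmin_at ?F [z] y \<longleftrightarrow> y = a + b" for y
    proof
      assume y: "pmin_at ?F [z] y"
      then have "z < triangle (Suc y)" by (auto simp: pmin_at_def)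
      then have "triangle (a + b) < triangle (Suc y)" using z by linarith
      then have "a + b \<le> y" using strict_mono_less[OF strict_mono_triangle] less_Suc_eq_le by blast
      moreover have "\<not> a + b < y"
        using y z by (auto simp: pmin_at_def)
      ultimately show "y = a + b" by simp
    next
      assume y: "y = a + b"
      have "triangle (Suc x) \<le> triangle (a + b)" if "x < a + b" for x
        using that strict_mono_less_eq[OF strict_mono_triangle] Suc_le_eq by blast
      then show "pmin_at ?F [z] y"
        unfolding pmin_at_def y z by (auto simp: less_Suc_eq_le trans_le_add1 simp del: triangle_Suc) (simp)
    qed
    then have "pmin_at ?F [z] = (\<lambda>y. y = a + b)" by blast
    then show ?thesis by (simp only: pmin_def ab) simp
  qed
  then have "Some (?s (xs ! 0)) = pmin ?F xs" if "length xs = 1" for xs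
    using that by (auto simp: length_Suc_conv)
  then have "total_recursive 1 (\<lambda>xs. ?s (xs ! 0))"
    unfolding total_recursive_def by (rule partial_recursive.ext[OF pmin])
  then show ?thesis
    using assms by (rule total_recursive_comp1)
qed

lemma total_recursive_prod_decode:
  assumes "total_recursive n f"
  shows "total_recursive n (\<lambda>xs. fst (prod_decode (f xs)))"
    and "total_recursive n (\<lambda>xs. snd (prod_decode (f xs)))"
proof -
  let ?s = "\<lambda>z. fst (prod_decode z) + snd (prod_decode z)"
  have 1: "fst (prod_decode z) = z - triangle (?s z)" for z
    using prod_decode_inverse[of z] by (simp add: prod_encode_def case_prod_beta)
  have 2: "snd (prod_decode z) = ?s z - fst (prod_decode z)" for z
    by simp
  show F: "total_recursive n (\<lambda>xs. fst (prod_decode (f xs)))"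
    by (subst 1) (intro total_recursive_diff total_recursive_triangle
      total_recursive_prod_decode_sum assms)
  show "total_recursive n (\<lambda>xs. snd (prod_decode (f xs)))"
    by (subst 2) (intro total_recursive_diff F total_recursive_prod_decode_sum assms)
qed

section \<open>Computable functions between encoded types\<close>

class encodable =
  fixes enc :: "'a \<Rightarrow> nat"

instantiation nat :: encodable
begin
definition enc_nat :: "nat \<Rightarrow> nat" where [simp]: "enc_nat n = n"
instance ..
end

instantiation bool :: encodable
begin
definition enc_bool :: "bool \<Rightarrow> nat" where "enc_bool b = (if b then 1 else 0)"
instance ..
end

instantiation prod :: (encodable, encodable) encodable
begin
definition enc_prod :: "'a \<times> 'b \<Rightarrow> nat"
  where [simp]: "enc_prod p = prod_encode (enc (fst p), enc (snd p))"
instance ..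
end

text \<open>Both this and the code of pairs follow \<open>encode_mat\<close>, so that
  \<open>enc\<close> reproduces the prescribed code of a matrix literally.\<close>

instantiation list :: (encodable) encodable
begin
definition enc_list :: "'a list \<Rightarrow> nat" where "enc_list xs = list_encode (map enc xs)"
instance ..
end

text \<open>In this form a case split on a list becomes a zero test followed by unpairing the
  predecessor.\<close>

lemma enc_Nil [simp]: "enc [] = 0"
  and enc_Cons [simp]: "enc (x # xs) = Suc (prod_encode (enc x, enc xs))"
  by (simp_all add: enc_list_def)

text \<open>The realiser \<open>g\<close> is constrained only at codes and free elsewhere, so
  realisers compose without any test of whether a number is a code.\<close>

definition computable :: "('a::encodable \<Rightarrow> 'b::encodable) \<Rightarrow> bool"
  where "computable f \<longleftrightarrow>
    (\<exists>g. total_recursive 1 (\<lambda>xs. g (xs ! 0)) \<and> (\<forall>x. g (enc x) = enc (f x)))"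

lemma computableI:
  assumes "total_recursive 1 (\<lambda>xs. g (xs ! 0))" and "\<And>x. g (enc x) = enc (f x)"
  shows "computable f"
  using assms unfolding computable_def by blast

text \<open>The realiser comes with closure under substitution at every arity, the shape in which it
  can be used next to \<open>total_recursive_intros\<close>.\<close>

lemma computableE:
  assumes "computable f"
  obtains g where "\<And>n h. total_recursive n h \<Longrightarrow> total_recursive n (\<lambda>xs. g (h xs))"
    and "\<And>x. g (enc x) = enc (f x)"
  using assms total_recursive_comp1 unfolding computable_def by blast

named_theorems computable_intros

lemmas total_recursive_intros = total_recursive_const total_recursive_nth total_recursive_Suc
  total_recursive_add total_recursive_mult total_recursive_diff total_recursive_prod_encode
  total_recursive_prod_decode

lemma computable_const [computable_intros]: "computable (\<lambda>x. c)"
  by (rule computableI[of "\<lambda>_. enc c"]) (auto intro: total_recursive_const)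

lemma computable_id [computable_intros]: "computable (\<lambda>x. x)"
  by (rule computableI[of "\<lambda>c. c"]) (auto intro: total_recursive_nth)

lemma computable_comp:
  assumes "computable f" and "computable g"
  shows "computable (\<lambda>x. f (g x))"
proof -
  obtain f' where f: "\<And>n h. total_recursive n h \<Longrightarrow> total_recursive n (\<lambda>xs. f' (h xs))"
      "\<And>x. f' (enc x) = enc (f x)" using computableE[OF assms(1)] by blast
  obtain g' where g: "\<And>n h. total_recursive n h \<Longrightarrow> total_recursive n (\<lambda>xs. g' (h xs))"
      "\<And>x. g' (enc x) = enc (g x)" using computableE[OF assms(2)] by blast
  show ?thesis
    by (rule computableI[of "\<lambda>c. f' (g' c)"]) (auto intro!: f g total_recursive_intros simp: f(2) g(2))
qed

lemma computable_Pair [computable_intros]: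
  assumes "computable f" and "computable g"
  shows "computable (\<lambda>x. (f x, g x))"
proof -
  obtain f' where f: "\<And>n h. total_recursive n h \<Longrightarrow> total_recursive n (\<lambda>xs. f' (h xs))"
      "\<And>x. f' (enc x) = enc (f x)" using computableE[OF assms(1)] by blast
  obtain g' where g: "\<And>n h. total_recursive n h \<Longrightarrow> total_recursive n (\<lambda>xs. g' (h xs))"
      "\<And>x. g' (enc x) = enc (g x)" using computableE[OF assms(2)] by blast
  show ?thesis
    by (rule computableI[of "\<lambda>c. prod_encode (f' c, g' c)"])
      (auto intro!: f g total_recursive_intros simp: f(2) g(2))
qed

lemma computable_fst [computable_intros]:
  assumes "computable f" shows "computable (\<lambda>x. fst (f x))"
  by (rule computable_comp[OF _ assms], rule computableI[of "\<lambda>c. fst (prod_decode c)"])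
    (auto intro!: total_recursive_intros)

lemma computable_snd [computable_intros]:
  assumes "computable f" shows "computable (\<lambda>x. snd (f x))"
  by (rule computable_comp[OF _ assms], rule computableI[of "\<lambda>c. snd (prod_decode c)"])
    (auto intro!: total_recursive_intros)

lemma computable_comp2:
  assumes "computable (\<lambda>p. F (fst p) (snd p))" and "computable f" and "computable g"
  shows "computable (\<lambda>x. F (f x) (g x))"
  using computable_comp[OF assms(1) computable_Pair[OF assms(2,3)]] by simp

lemma computable_comp3:
  assumes "computable (\<lambda>p. F (fst p) (fst (snd p)) (snd (snd p)))"
    and "computable f" and "computable g" and "computable h"
  shows "computable (\<lambda>x. F (f x) (g x) (h x))"
  using computable_comp[OF assms(1) computable_Pair[OF assms(2) computable_Pair[OF assms(3,4)]]]
  by simp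

text \<open>Realised by the identity. Having the code as a number supplies the iteration bound in
  \<open>computable_fold\<close>.\<close>

lemma computable_enc [computable_intros]:
  assumes "computable f" shows "computable (\<lambda>x. enc (f x))"
  by (rule computable_comp[OF _ assms], rule computableI[of "\<lambda>c. c"])
    (auto intro!: total_recursive_intros)

lemma computable_Suc [computable_intros]:
  assumes "computable f" shows "computable (\<lambda>x. Suc (f x))"
  by (rule computable_comp[OF _ assms], rule computableI[of Suc])
    (auto intro!: total_recursive_intros)

lemma computable_add_nat [computable_intros]:
  fixes f g :: "'a::encodable \<Rightarrow> nat"
  assumes "computable f" "computable g"
  shows "computable (\<lambda>x. f x + g x)"
  by (rule computable_comp2[OF _ assms],
      rule computableI[of "\<lambda>c. fst (prod_decode c) + snd (prod_decode c)"])
    (auto intro!: total_recursive_intros)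

lemma computable_mult_nat [computable_intros]:
  fixes f g :: "'a::encodable \<Rightarrow> nat"
  assumes "computable f" "computable g"
  shows "computable (\<lambda>x. f x * g x)"
  by (rule computable_comp2[OF _ assms],
      rule computableI[of "\<lambda>c. fst (prod_decode c) * snd (prod_decode c)"])
    (auto intro!: total_recursive_intros)

lemma computable_diff_nat [computable_intros]:
  fixes f g :: "'a::encodable \<Rightarrow> nat"
  assumes "computable f" "computable g"
  shows "computable (\<lambda>x. f x - g x)"
  by (rule computable_comp2[OF _ assms],
      rule computableI[of "\<lambda>c. fst (prod_decode c) - snd (prod_decode c)"])
    (auto intro!: total_recursive_intros)

lemma computable_eq_nat [computable_intros]:
  fixes f g :: "'a::encodable \<Rightarrow> nat"
  assumes "computable f" "computable g"
  shows "computable (\<lambda>x. f x = g x)"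
  by (rule computable_comp2[OF _ assms],
      rule computableI[of "\<lambda>c. 1 - ((fst (prod_decode c) - snd (prod_decode c)) +
        (snd (prod_decode c) - fst (prod_decode c)))"])
    (auto intro!: total_recursive_intros simp: enc_bool_def simp del: One_nat_def)

lemma computable_If [computable_intros]:
  assumes "computable b" and "computable f" and "computable g"
  shows "computable (\<lambda>x. if b x then f x else g x)"
  \<comment> \<open>The code of the condition is 0 or 1 and selects a branch as an arithmetic
    factor.\<close>
  by (rule computable_comp3[OF _ assms], rule computableI[of "\<lambda>c.
      fst (prod_decode c) * fst (prod_decode (snd (prod_decode c))) +
      (1 - fst (prod_decode c)) * snd (prod_decode (snd (prod_decode c)))"])
    (auto intro!: total_recursive_intros simp: enc_bool_def simp del: One_nat_def)

lemma computable_Not [computable_intros]: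
  assumes "computable b"
  shows "computable (\<lambda>x. \<not> b x)"
proof -
  have "computable (\<lambda>x. if b x then False else True)"
    by (intro computable_intros assms)
  moreover have "(if b x then False else True) = (\<not> b x)" for x by simp
  ultimately show ?thesis by (simp only:)
qed

lemma computable_conj [computable_intros]:
  assumes "computable b" and "computable c"
  shows "computable (\<lambda>x. b x \<and> c x)"
proof -
  have "computable (\<lambda>x. if b x then c x else False)"
    by (intro computable_intros assms)
  moreover have "(if b x then c x else False) = (b x \<and> c x)" for x by simp
  ultimately show ?thesis by (simp only:)
qed

section \<open>Recursion on numbers, folds and list operations\<close>

lemma computable_rec_nat [computable_intros]:
  assumes "computable a" and "computable (\<lambda>p. h (fst p) (fst (snd p)) (snd (snd p)))"
    and "computable n"
  shows "computable (\<lambda>x. rec_nat (a x) (\<lambda>k r. h x k r) (n x))"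
proof -
  obtain a' where a: "\<And>n h. total_recursive n h \<Longrightarrow> total_recursive n (\<lambda>xs. a' (h xs))"
      "\<And>x. a' (enc x) = enc (a x)" using computableE[OF assms(1)] by blast
  obtain h' where h: "\<And>n f. total_recursive n f \<Longrightarrow> total_recursive n (\<lambda>xs. h' (f xs))"
      "\<And>p. h' (enc p) = enc (h (fst p) (fst (snd p)) (snd (snd p)))"
    using computableE[OF assms(2)] by blast
  obtain n' where n: "\<And>m h. total_recursive m h \<Longrightarrow> total_recursive m (\<lambda>xs. n' (h xs))"
      "\<And>x. n' (enc x) = enc (n x)" using computableE[OF assms(3)] by blast
  let ?step = "\<lambda>c k r. h' (prod_encode (c, prod_encode (k, r)))"
  have "total_recursive 1 (\<lambda>xs. rec_nat (a' (xs ! 0)) (?step (xs ! 0)) (n' (xs ! 0)))"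
    by (rule total_recursive_rec_nat2) (auto intro!: a(1) h(1) n(1) total_recursive_intros)
  moreover have "rec_nat (a' (enc x)) (?step (enc x)) m = enc (rec_nat (a x) (\<lambda>k r. h x k r) m)" for x m
    using h(2)[of "(x, k, r)" for k r] by (induction m) (simp_all add: a(2))
  ultimately show ?thesis
    using n(2) by (intro computableI) (auto simp: n(2))
qed

lemma computable_Cons [computable_intros]:
  assumes "computable f" and "computable g"
  shows "computable (\<lambda>x. f x # g x)"
  by (rule computable_comp2[OF _ assms], rule computableI[of Suc])
    (auto intro!: total_recursive_intros)

lemma computable_case_list [computable_intros]:
  assumes "computable l" and "computable a"
    and "computable (\<lambda>p. h (fst p) (fst (snd p)) (snd (snd p)))"
  shows "computable (\<lambda>x. case l x of [] \<Rightarrow> a x | y # ys \<Rightarrow> h x y ys)"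
proof -
  obtain a' where a: "\<And>n h. total_recursive n h \<Longrightarrow> total_recursive n (\<lambda>xs. a' (h xs))"
      "\<And>x. a' (enc x) = enc (a x)" using computableE[OF assms(2)] by blast
  obtain h' where h: "\<And>n f. total_recursive n f \<Longrightarrow> total_recursive n (\<lambda>xs. h' (f xs))"
      "\<And>p. h' (enc p) = enc (h (fst p) (fst (snd p)) (snd (snd p)))"
    using computableE[OF assms(3)] by blast
  obtain l' where l: "\<And>n h. total_recursive n h \<Longrightarrow> total_recursive n (\<lambda>xs. l' (h xs))"
      "\<And>x. l' (enc x) = enc (l x)" using computableE[OF assms(1)] by blast
  have h': "h' (prod_encode (enc x, prod_encode (enc y, enc ys))) = enc (h x y ys)" for x y ys
    using h(2)[of "(x, y, ys)"] by simp
  show ?thesis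
    \<comment> \<open>Nonempty lists have positive codes, so \<open>1 - l' c\<close> is 1 for the
      empty list and 0 otherwise. In the latter case \<open>l' c - 1\<close> is the code of the pair
      of head and tail.\<close>
    by (rule computableI[of "\<lambda>c. (1 - l' c) * a' c +
        (1 - (1 - l' c)) * h' (prod_encode (c, l' c - 1))"])
      (auto intro!: a(1) h(1) l(1) total_recursive_intros
        simp: a(2) l(2) h' simp del: One_nat_def split: list.split)
qed

lemma length_le_enc: "length xs \<le> enc xs"
  by (induction xs) (auto intro: order_trans[OF _ le_prod_encode_2])

text \<open>The iterated \<open>step\<close> consumes one element and idles on the empty list, so
  any number of rounds at least the length gives the fold. The code of the list is such a number, by
  \<open>length_le_enc\<close>.\<close>

lemma computable_fold [computable_intros]:
  assumes "computable (\<lambda>p. h (fst p) (fst (snd p)) (snd (snd p)))"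
    and "computable l" and "computable a"
  shows "computable (\<lambda>x. fold (\<lambda>y r. h x y r) (l x) (a x))"
proof -
  define step where "step x s =
    (case snd s of [] \<Rightarrow> s | y # ys \<Rightarrow> (h x y (fst s), ys))" for x s
  have step: "step x (r, y # ys) = (h x y r, ys)" "step x (r, []) = (r, [])" for x r y ys
    by (simp_all add: step_def)
  have "rec_nat (r, ys) (\<lambda>_. step x) n = (fold (h x) (take n ys) r, drop n ys)" for x r ys n
  proof (induction n)
    case (Suc n)
    show ?case
    proof (cases "n < length ys")
      case True
      then show ?thesis
        using Cons_nth_drop_Suc[OF True, symmetric]
        by (simp add: Suc step take_Suc_conv_app_nth)
    qed (simp add: Suc step)
  qed simp
  then have fold: "fold (h x) ys r = fst (rec_nat (r, ys) (\<lambda>_. step x) (enc ys))" for x r ys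
    using length_le_enc[of ys] by simp
  have "computable (\<lambda>p. step (fst p) (snd (snd p)))"
    unfolding step_def by (intro computable_intros)
      (auto intro!: computable_comp3[OF assms(1)] computable_intros)
  then show ?thesis
    unfolding fold by (intro computable_intros assms)
qed

lemma computable_power_nat [computable_intros]:
  fixes f g :: "'a::encodable \<Rightarrow> nat"
  assumes "computable f" and "computable g"
  shows "computable (\<lambda>x. f x ^ g x)"
proof -
  have "rec_nat 1 (\<lambda>_ r. r * a) b = a ^ b" for a b :: nat
    by (induction b) auto
  moreover have "computable (\<lambda>p :: nat \<times> nat. rec_nat 1 (\<lambda>_ r. r * fst p) (snd p))"
    by (intro computable_intros)
  ultimately have "computable (\<lambda>p :: nat \<times> nat. fst p ^ snd p)" by simp
  then show ?thesis using assms by (rule computable_comp2)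
qed

lemma computable_even [computable_intros]:
  assumes "computable f"
  shows "computable (\<lambda>x. even (f x :: nat))"
proof -
  have "rec_nat True (\<lambda>_ r. \<not> r) n = even n" for n
    by (induction n) auto
  moreover have "computable (\<lambda>x. rec_nat True (\<lambda>_ r. \<not> r) (f x))"
    by (intro computable_intros assms)
  ultimately show ?thesis by simp
qed

lemma computable_half [computable_intros]:
  assumes "computable f"
  shows "computable (\<lambda>x. f x div (2 :: nat))"
proof -
  have "rec_nat 0 (\<lambda>k r. if even k then r else Suc r) n = n div 2" for n
    by (induction n) auto
  moreover have "computable (\<lambda>x. rec_nat 0 (\<lambda>k r. if even k then r else Suc r) (f x))"
    by (intro computable_intros assms)
  ultimately show ?thesis by simp
qed

lemma computable_all_less [computable_intros]:
  fixes P :: "'a::encodable \<Rightarrow> nat \<Rightarrow> bool"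
  assumes "computable n" and "computable (\<lambda>p. P (fst p) (snd p))"
  shows "computable (\<lambda>x. \<forall>k<n x. P x k)"
proof -
  have "rec_nat True (\<lambda>k r. r \<and> P x k) m = (\<forall>k<m. P x k)" for x m
    by (induction m) (auto simp: less_Suc_eq)
  moreover have "computable (\<lambda>x. rec_nat True (\<lambda>k r. r \<and> P x k) (n x))"
    by (intro computable_intros assms computable_comp2[OF assms(2)])
  ultimately show ?thesis by simp
qed

lemma computable_length [computable_intros]:
  fixes l :: "'a::encodable \<Rightarrow> 'b::encodable list"
  assumes "computable l"
  shows "computable (\<lambda>x. length (l x))"
proof -
  have "fold (\<lambda>_ r. Suc r) xs n = n + length xs" for n and xs :: "'b list"
    by (induction xs arbitrary: n) auto
  moreover have "computable (\<lambda>x. fold (\<lambda>_ r. Suc r) (l x) 0)"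
    by (intro computable_intros assms)
  ultimately show ?thesis by simp
qed

lemma computable_rev [computable_intros]:
  assumes "computable l"
  shows "computable (\<lambda>x. rev (l x))"
proof -
  have "computable (\<lambda>x. fold (\<lambda>y r. y # r) (l x) [])"
    by (intro computable_intros assms)
  then show ?thesis by (simp add: rev_conv_fold)
qed

lemma computable_map [computable_intros]:
  assumes "computable (\<lambda>p. h (fst p) (snd p))" and "computable l"
  shows "computable (\<lambda>x. map (\<lambda>y. h x y) (l x))"
proof -
  have "fold (\<lambda>y r. h x y # r) ys zs = rev (map (h x) ys) @ zs" for x ys zs
    by (induction ys arbitrary: zs) auto
  then have "map (h x) ys = rev (fold (\<lambda>y r. h x y # r) ys [])" for x ys
    by simp
  moreover have "computable (\<lambda>x. rev (fold (\<lambda>y r. h x y # r) (l x) []))"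
    by (intro computable_intros assms computable_comp2[OF assms(1)])
  ultimately show ?thesis by simp
qed

lemma computable_append [computable_intros]:
  assumes "computable f" and "computable g"
  shows "computable (\<lambda>x. f x @ g x)"
proof -
  have "computable (\<lambda>x. fold (\<lambda>y r. y # r) (rev (f x)) (g x))"
    by (intro computable_intros assms)
  then show ?thesis by (simp add: fold_Cons_rev)
qed

lemma computable_concat [computable_intros]:
  fixes l :: "'a::encodable \<Rightarrow> 'b::encodable list list"
  assumes "computable l"
  shows "computable (\<lambda>x. concat (l x))"
proof -
  have "fold (\<lambda>y r. r @ y) yss zs = zs @ concat yss" for zs and yss :: "'b list list"
    by (induction yss arbitrary: zs) auto
  moreover have "computable (\<lambda>x. fold (\<lambda>y r. r @ y) (l x) [])"
    by (intro computable_intros assms)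
  ultimately show ?thesis by simp
qed

lemma computable_list_all [computable_intros]:
  assumes "computable (\<lambda>p. P (fst p) (snd p))" and "computable l"
  shows "computable (\<lambda>x. list_all (\<lambda>y. P x y) (l x))"
proof -
  have "fold (\<lambda>y r. r \<and> P x y) ys b = (b \<and> list_all (P x) ys)" for x ys b
    by (induction ys arbitrary: b) auto
  moreover have "computable (\<lambda>x. fold (\<lambda>y r. r \<and> P x y) (l x) True)"
    by (intro computable_intros assms computable_comp2[OF assms(1)])
  ultimately show ?thesis by simp
qed

lemma computable_list_ex [computable_intros]:
  assumes "computable (\<lambda>p. P (fst p) (snd p))" and "computable l"
  shows "computable (\<lambda>x. list_ex (\<lambda>y. P x y) (l x))"
proof -
  have "computable (\<lambda>x. \<not> list_all (\<lambda>y. \<not> P x y) (l x))"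
    by (intro computable_intros assms computable_comp2[OF assms(1)])
  then show ?thesis by (simp add: list_all_iff list_ex_iff)
qed

lemma computable_upt [computable_intros]:
  assumes "computable n"
  shows "computable (\<lambda>x. [0..<n x])"
proof -
  have "rec_nat [] (\<lambda>k r. r @ [k]) m = [0..<m]" for m
    by (induction m) auto
  moreover have "computable (\<lambda>x. rec_nat [] (\<lambda>k r. r @ [k]) (n x))"
    by (intro computable_intros assms)
  ultimately show ?thesis by simp
qed

text \<open>A realiser must also answer past the end of the list; \<open>nth_default\<close> fixes
  the answer there.\<close>

lemma computable_nth_default [computable_intros]:
  fixes l :: "'a::encodable \<Rightarrow> 'b::encodable list"
  assumes "computable l" and "computable i"
  shows "computable (\<lambda>x. nth_default a (l x) (i x))"
proof -
  have rec: "rec_nat xs (\<lambda>_ r. case r of [] \<Rightarrow> r | y # ys \<Rightarrow> ys) n = drop n xs"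
    for n and xs :: "'b list"
  proof -
    have "(case r of [] \<Rightarrow> r | y # ys \<Rightarrow> ys) = tl r" for r :: "'b list"
      by (cases r) auto
    then show ?thesis
      by (induction n) (simp_all add: drop_Suc tl_drop)
  qed
  have "computable (\<lambda>x. case rec_nat (l x) (\<lambda>_ r. case r of [] \<Rightarrow> r | y # ys \<Rightarrow> ys) (i x) of
      [] \<Rightarrow> a | y # ys \<Rightarrow> y)"
    by (intro computable_intros assms)
  moreover have "(case drop n xs of [] \<Rightarrow> a | y # ys \<Rightarrow> y) = nth_default a xs n" for n xs
    by (cases "n < length xs") (simp_all add: nth_default_def flip: Cons_nth_drop_Suc)
  ultimately show ?thesis by (simp only: rec)
qed

section \<open>The decision procedure\<close>

text \<open>
  The tuple \<open>(p, m, p', m', k)\<close> of naturals stands for \<open>((p - m) + (p' - m') \<i>) / (k + 1)\<close>: no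
  subtraction is needed in the arithmetic, and every tuple is meaningful.
\<close>

type_synonym gnum = "nat \<times> nat \<times> nat \<times> nat \<times> nat"

definition gval :: "gnum \<Rightarrow> complex"
  where "gval = (\<lambda>(p, m, p', m', k). Complex ((real p - real m) / real (Suc k))
    ((real p' - real m') / real (Suc k)))"

definition gzero :: gnum
  where "gzero = (0, 0, 0, 0, 0)"

text \<open>The last component is the predecessor of the common denominator
  \<open>Suc k * Suc l\<close>; storing predecessors keeps every denominator positive.\<close>

definition gadd :: "gnum \<Rightarrow> gnum \<Rightarrow> gnum"
  where "gadd x y = (case x of (p, m, p', m', k) \<Rightarrow> case y of (q, n, q', n', l) \<Rightarrow>
    (p * Suc l + q * Suc k, m * Suc l + n * Suc k,
     p' * Suc l + q' * Suc k, m' * Suc l + n' * Suc k, k * l + k + l))"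

text \<open>The complex product multiplied out, with the terms of each part sorted by sign into its
  positive and its negative component.\<close>

definition gmult :: "gnum \<Rightarrow> gnum \<Rightarrow> gnum"
  where "gmult x y = (case x of (p, m, p', m', k) \<Rightarrow> case y of (q, n, q', n', l) \<Rightarrow>
    (p * q + m * n + p' * n' + m' * q', p * n + m * q + p' * q' + m' * n',
     p * q' + m * n' + p' * q + m' * n, p * n' + m * q' + p' * n + m' * q, k * l + k + l))"

text \<open>A number has many such tuples, so equality is cross-multiplied, with the subtracted
  terms moved to the other side.\<close>

definition geq :: "gnum \<Rightarrow> gnum \<Rightarrow> bool"
  where "geq x y \<longleftrightarrow> (case x of (p, m, p', m', k) \<Rightarrow> case y of (q, n, q', n', l) \<Rightarrow>
    p * Suc l + n * Suc k = q * Suc k + m * Suc l \<and>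
    p' * Suc l + n' * Suc k = q' * Suc k + m' * Suc l)"

lemma gval_gzero: "gval gzero = 0"
  by (simp add: gval_def gzero_def complex_eq_iff)

lemma gval_gadd: "gval (gadd x y) = gval x + gval y"
proof -
  obtain p m p' m' k q n q' n' l where xy: "x = (p, m, p', m', k)" "y = (q, n, q', n', l)"
    by (metis prod.exhaust)
  have "real (Suc (k * l + k + l)) = real (Suc k) * real (Suc l)"
    by (simp add: algebra_simps)
  moreover have "real (Suc k) > 0" "real (Suc l) > 0" by simp_all
  ultimately show ?thesis
    unfolding xy gval_def gadd_def prod.case
    by (simp only: of_nat_add of_nat_mult) (simp add: field_simps complex_eq_iff del: of_nat_Suc)
qed

lemma gval_gmult: "gval (gmult x y) = gval x * gval y"
proof -
  obtain p m p' m' k q n q' n' l where xy: "x = (p, m, p', m', k)" "y = (q, n, q', n', l)"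
    by (metis prod.exhaust)
  have "real (Suc (k * l + k + l)) = real (Suc k) * real (Suc l)"
    by (simp add: algebra_simps)
  moreover have "real (Suc k) > 0" "real (Suc l) > 0" by simp_all
  ultimately show ?thesis
    unfolding xy gval_def gmult_def prod.case
    by (simp only: of_nat_add of_nat_mult) (simp add: field_simps complex_eq_iff del: of_nat_Suc)
qed

lemma geq_iff: "geq x y \<longleftrightarrow> gval x = gval y"
proof -
  obtain p m p' m' k q n q' n' l where xy: "x = (p, m, p', m', k)" "y = (q, n, q', n', l)"
    by (metis prod.exhaust)
  have frac: "a * l + d * k = c * k + b * l \<longleftrightarrow> (a - b) / k = (c - d) / l"
    if "k > 0" "l > 0" for a b c d k l :: real
    using that by (simp add: frac_eq_eq left_diff_distrib) argo
  have "(a * Suc l + d * Suc k = c * Suc k + b * Suc l) \<longleftrightarrow>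
      (real a - real b) / real (Suc k) = (real c - real d) / real (Suc l)" for a b c d
  proof -
    have "(a * Suc l + d * Suc k = c * Suc k + b * Suc l) \<longleftrightarrow>
        real a * real (Suc l) + real d * real (Suc k) = real c * real (Suc k) + real b * real (Suc l)"
      by (simp only: of_nat_add of_nat_mult flip: of_nat_eq_iff[where 'a = real])
    also have "\<dots> \<longleftrightarrow> (real a - real b) / real (Suc k) = (real c - real d) / real (Suc l)"
      by (rule frac) simp_all
    finally show ?thesis .
  qed
  then show ?thesis
    unfolding xy gval_def geq_def prod.case by simp
qed

lemma computable_gadd:
  "computable f \<Longrightarrow> computable g \<Longrightarrow> computable (\<lambda>x. gadd (f x) (g x))"
  by (erule (1) computable_comp2[rotated])
    (unfold gadd_def case_prod_beta, intro computable_intros)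

lemma computable_gmult:
  "computable f \<Longrightarrow> computable g \<Longrightarrow> computable (\<lambda>x. gmult (f x) (g x))"
  by (erule (1) computable_comp2[rotated])
    (unfold gmult_def case_prod_beta, intro computable_intros)

lemma computable_geq:
  "computable f \<Longrightarrow> computable g \<Longrightarrow> computable (\<lambda>x. geq (f x) (g x))"
  by (erule (1) computable_comp2[rotated])
    (unfold geq_def case_prod_beta, intro computable_intros)

lemmas [computable_intros] = computable_gadd computable_gmult computable_geq

section \<open>Matrices, states and words over Gaussian rationals\<close>

definition gsum :: "(nat \<Rightarrow> gnum) \<Rightarrow> nat \<Rightarrow> gnum"
  where "gsum f n = rec_nat gzero (\<lambda>k r. gadd r (f k)) n"

lemma gval_gsum: "gval (gsum f n) = (\<Sum>k<n. gval (f k))"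
  by (induction n) (simp_all add: gsum_def gval_gzero gval_gadd)

lemma computable_gsum [computable_intros]:
  assumes "computable n" and "computable (\<lambda>p. f (fst p) (snd p))"
  shows "computable (\<lambda>x. gsum (\<lambda>k. f x k) (n x))"
  unfolding gsum_def by (intro computable_intros assms computable_comp2[OF assms(2)])

type_synonym gmat = "gnum list list"

definition gentry :: "gmat \<Rightarrow> nat \<Rightarrow> nat \<Rightarrow> gnum"
  where "gentry M i j = nth_default gzero (nth_default [] M i) j"

text \<open>A state is stored as the row-major vector of its \<open>d * d\<close> entries, on which
  a super-operator acts as an ordinary matrix.\<close>

definition gstep :: "nat \<Rightarrow> gmat \<Rightarrow> gnum list \<Rightarrow> gnum list"
  where "gstep d E v =
    map (\<lambda>r. gsum (\<lambda>c. gmult (gentry E r c) (nth_default gzero v c)) (d * d)) [0..<d * d]"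

text \<open>The test \<open>P * \<sigma> = \<sigma>\<close>, entry by entry, for \<sigma> in
  row-major form.\<close>

definition gfixed :: "nat \<Rightarrow> gmat \<Rightarrow> gnum list \<Rightarrow> bool"
  where "gfixed d P v \<longleftrightarrow> (\<forall>i<d. \<forall>j<d.
    geq (gsum (\<lambda>k. gmult (gentry P i k) (nth_default gzero v (k * d + j))) d)
      (nth_default gzero v (i * d + j)))"

text \<open>Retaining \<open>vs\<close> in every round gives all words up to length
  \<open>n\<close>, not just those of length \<open>n\<close>. Repeated states are kept.\<close>

definition greach :: "nat \<Rightarrow> gmat list \<Rightarrow> gnum list \<Rightarrow> nat \<Rightarrow> gnum list list"
  where "greach d Es v n =
    rec_nat [v] (\<lambda>_ vs. vs @ concat (map (\<lambda>E. map (gstep d E) vs) Es)) n"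

definition decide :: "nat \<Rightarrow> gmat list \<Rightarrow> gmat \<Rightarrow> gmat list \<Rightarrow> bool"
  where "decide d Es \<rho> Ps \<longleftrightarrow>
    list_all (\<lambda>v. list_ex (\<lambda>P. gfixed d P v) Ps) (greach d Es (concat \<rho>) ((d * d) ^ length Ps))"

lemma set_greach:
  "set (greach d Es v n) = {fold (gstep d) w v | w. w \<in> lists (set Es) \<and> length w \<le> n}"
proof (induction n)
  case 0
  then show ?case by (auto simp: greach_def)
next
  case (Suc n)
  let ?R = "\<lambda>n. {fold (gstep d) w v | w. w \<in> lists (set Es) \<and> length w \<le> n}"
  have "set (greach d Es v (Suc n)) = ?R n \<union> {gstep d E u | E u. E \<in> set Es \<and> u \<in> ?R n}"
  proof -
    have "set (greach d Es v (Suc n)) =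
        set (greach d Es v n) \<union> (\<Union>E\<in>set Es. gstep d E ` set (greach d Es v n))"
      by (simp add: greach_def)
    then show ?thesis unfolding Suc.IH by blast
  qed
  also have "\<dots> = ?R (Suc n)"
  proof (intro equalityI subsetI)
    fix u assume "u \<in> ?R n \<union> {gstep d E u | E u. E \<in> set Es \<and> u \<in> ?R n}"
    then consider "u \<in> ?R n"
      | E w where "E \<in> set Es" "w \<in> lists (set Es)" "length w \<le> n" "u = gstep d E (fold (gstep d) w v)"
      by blast
    then show "u \<in> ?R (Suc n)"
    proof cases
      case 1
      then show ?thesis using le_SucI by blast
    next
      case 2
      then have "u = fold (gstep d) (w @ [E]) v" "w @ [E] \<in> lists (set Es)" "length (w @ [E]) \<le> Suc n"
        by auto
      then show ?thesis by blast
    qed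
  next
    fix u assume "u \<in> ?R (Suc n)"
    then obtain w where w: "u = fold (gstep d) w v" "w \<in> lists (set Es)" "length w \<le> Suc n"
      by blast
    show "u \<in> ?R n \<union> {gstep d E u | E u. E \<in> set Es \<and> u \<in> ?R n}"
    proof (cases w rule: rev_cases)
      case Nil
      then have "length w \<le> n" by simp
      then show ?thesis using w by blast
    next
      case (snoc w' E)
      then have "u = gstep d E (fold (gstep d) w' v)" "E \<in> set Es" "w' \<in> lists (set Es)" "length w' \<le> n"
        using w by auto
      then show ?thesis by blast
    qed
  qed
  finally show ?case .
qed

lemma decide_iff:
  "decide d Es \<rho> Ps \<longleftrightarrow> (\<forall>w \<in> lists (set Es). length w \<le> (d * d) ^ length Ps \<longrightarrow>
    (\<exists>P\<in>set Ps. gfixed d P (fold (gstep d) w (concat \<rho>))))"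
  unfolding decide_def list_all_iff list_ex_iff set_greach by blast

lemma computable_gentry [computable_intros]:
  assumes "computable M" and "computable i" and "computable j"
  shows "computable (\<lambda>x. gentry (M x) (i x) (j x))"
  unfolding gentry_def by (intro computable_intros assms)

lemma computable_gstep [computable_intros]:
  assumes "computable d" and "computable E" and "computable v"
  shows "computable (\<lambda>x. gstep (d x) (E x) (v x))"
  by (rule computable_comp3[OF _ assms]) (unfold gstep_def, intro computable_intros)

lemma computable_gfixed [computable_intros]:
  assumes "computable d" and "computable P" and "computable v"
  shows "computable (\<lambda>x. gfixed (d x) (P x) (v x))"
  by (rule computable_comp3[OF _ assms]) (unfold gfixed_def, intro computable_intros)

text \<open>
  A rational is presented as the pair of the \<^const>\<open>int_encode\<close> codes of its numerator and
  denominator; even codes are those of nonnegative integers.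
\<close>

type_synonym gcode = "(nat \<times> nat) \<times> (nat \<times> nat)"

definition pos_part_code :: "nat \<Rightarrow> nat"
  where "pos_part_code n = (if even n then n div 2 else 0)"

text \<open>The odd code \<open>2 * k + 1\<close> stands for the integer \<open>- (k + 1)\<close>,
  hence the successor.\<close>

definition neg_part_code :: "nat \<Rightarrow> nat"
  where "neg_part_code n = (if even n then 0 else Suc (n div 2))"

text \<open>Both parts are brought to the product of the two denominators. A denominator is
  positive, so halving its code recovers it; the final subtraction turns the product into the stored
  predecessor.\<close>

definition gnum_of_code :: "gcode \<Rightarrow> gnum"
  where "gnum_of_code = (\<lambda>((a, b), (c, d)).
    (pos_part_code a * (d div 2), neg_part_code a * (d div 2),
     pos_part_code c * (b div 2), neg_part_code c * (b div 2), (b div 2) * (d div 2) - 1))"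

definition code_of_gauss_rat :: "rat \<times> rat \<Rightarrow> gcode"
  where "code_of_gauss_rat q = (map_prod int_encode int_encode (quotient_of (fst q)),
    map_prod int_encode int_encode (quotient_of (snd q)))"

lemma parts_int_encode:
  "real (pos_part_code (int_encode i)) - real (neg_part_code (int_encode i)) = of_int i"
  by (auto simp: pos_part_code_def neg_part_code_def int_encode_def sum_encode_def)

lemma gval_gnum_of_code: "gval (gnum_of_code (code_of_gauss_rat q)) = gauss_rat q"
proof -
  obtain n m n' m' where q: "quotient_of (fst q) = (n, m)" "quotient_of (snd q) = (n', m')"
    by (metis prod.exhaust)
  have m: "m > 0" "m' > 0"
    using q quotient_of_denom_pos by blast+
  have half: "int_encode m div 2 = nat m" "int_encode m' div 2 = nat m'"
    using m by (simp_all add: int_encode_def sum_encode_def)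
  have "(of_rat (fst q) :: real) = of_int n / of_int m"
    using quotient_of_div[OF q(1)] by (simp add: of_rat_divide)
  moreover have "(of_rat (snd q) :: real) = of_int n' / of_int m'"
    using quotient_of_div[OF q(2)] by (simp add: of_rat_divide)
  moreover have "real (Suc (nat m * nat m' - 1)) = of_int m * of_int m'"
    using m by (simp flip: nat_mult_distrib)
  moreover have "real (x * nat m) - real (y * nat m) = (real x - real y) * of_int m"
    "real (x * nat m') - real (y * nat m') = (real x - real y) * of_int m'" for x y
    using m by (simp_all add: left_diff_distrib)
  ultimately show ?thesis
    using m by (simp add: gval_def gnum_of_code_def code_of_gauss_rat_def q half gauss_rat_def
        parts_int_encode del: of_nat_Suc of_nat_mult)
qed

definition decide_code :: "nat \<times> gcode list list list \<times> gcode list list \<times> gcode list list list \<Rightarrow> bool"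
  where "decide_code = (\<lambda>(d, Es, \<rho>, Ps).
    decide d (map (map (map gnum_of_code)) Es) (map (map gnum_of_code) \<rho>)
      (map (map (map gnum_of_code)) Ps))"

lemma computable_gnum_of_code [computable_intros]:
  assumes "computable f"
  shows "computable (\<lambda>x. gnum_of_code (f x))"
  by (rule computable_comp[OF _ assms])
    (unfold gnum_of_code_def pos_part_code_def neg_part_code_def case_prod_beta, intro computable_intros)

lemma computable_decide_code: "computable decide_code"
proof -
  have "computable (\<lambda>x. decide_code x)"
    unfolding decide_code_def decide_def greach_def case_prod_beta by (intro computable_intros)
  then show ?thesis by simp
qed

definition data_codes :: "rational_data \<Rightarrow> nat \<times> gcode list list list \<times> gcode list list \<times> gcode list list list"
  where "data_codes c = (rdim c, map (\<lambda>M. map (map code_of_gauss_rat) (mat_to_list M)) (rsuperops c),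
    map (map code_of_gauss_rat) (mat_to_list (rinit c)),
    map (\<lambda>M. map (map code_of_gauss_rat) (mat_to_list M)) (rprojs c))"

lemma encode_mat_eq_enc: "encode_mat M = enc (map (map code_of_gauss_rat) (mat_to_list M))"
proof -
  have "(\<lambda>(a, b). prod_encode (encode_rat a, encode_rat b)) = (\<lambda>q. enc (code_of_gauss_rat q))"
    by (auto simp: fun_eq_iff encode_rat_def code_of_gauss_rat_def)
  then show ?thesis
    by (simp add: encode_mat_def enc_list_def comp_def)
qed

lemma partial_recursive_decide:
  obtains f where "partial_recursive 1 f"
    and "\<And>c. f [encode_data c] = Some (if decide_code (data_codes c) then 1 else 0)"
proof -
  obtain g where g: "\<And>n h. total_recursive n h \<Longrightarrow> total_recursive n (\<lambda>xs. g (h xs))"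
      "\<And>x. g (enc x) = enc (decide_code x)"
    using computableE[OF computable_decide_code] by blast
  \<comment> \<open>\<open>encode_data\<close> codes a four-element list, while a tuple is coded by
    nested pairs. \<open>h\<close> and \<open>t\<close> extract head and tail of a list code, and
    \<open>r\<close> repacks the four entries as a tuple.\<close>
  define t where "t z = snd (prod_decode (z - 1))" for z
  define h where "h z = fst (prod_decode (z - 1))" for z
  define r where "r z = prod_encode (h z, prod_encode (h (t z), prod_encode (h (t (t z)), h (t (t (t z))))))" for z
  have "total_recursive 1 (\<lambda>xs. g (r (xs ! 0)))"
    unfolding r_def t_def h_def by (intro g total_recursive_intros) auto
  then have "partial_recursive 1 (\<lambda>xs. Some (g (r (xs ! 0))))"
    by (simp add: total_recursive_def)
  moreover have r: "r (encode_data c) = enc (data_codes c)" for c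
  proof -
    have "list_encode (map encode_mat Ms)
        = enc (map (\<lambda>M. map (map code_of_gauss_rat) (mat_to_list M)) Ms)" for Ms
    proof -
      have "map encode_mat Ms = map enc (map (\<lambda>M. map (map code_of_gauss_rat) (mat_to_list M)) Ms)"
        by (simp add: encode_mat_eq_enc)
      then show ?thesis by (simp only: enc_list_def)
    qed
    then show ?thesis
      by (simp add: r_def t_def h_def encode_data_def data_codes_def encode_mat_eq_enc)
  qed
  have "Some (g (r ([encode_data c] ! 0))) = Some (if decide_code (data_codes c) then 1 else 0)" for c
    by (simp only: nth_Cons_0 r g(2)) (simp add: enc_bool_def)
  ultimately show thesis by (rule that)
qed

section \<open>Words up to a bounded length suffice\<close>

text \<open>The functional \<open>g k\<close> vanishes on the span of the earlier vectors but not at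
  \<open>v k\<close>. The \<open>n\<close> vectors are therefore linearly independent in the space
  of functions on \<open>S\<close>, whose dimension is \<open>card S\<close>.\<close>

lemma triangular_system_card_bound:
  fixes v g :: "nat \<Rightarrow> 's \<Rightarrow> complex"
  assumes S: "finite S"
    and diag: "\<And>k. k < n \<Longrightarrow> (\<Sum>x\<in>S. g k x * v k x) \<noteq> 0"
    and lower: "\<And>j k. j < k \<Longrightarrow> k < n \<Longrightarrow> (\<Sum>x\<in>S. g k x * v j x) = 0"
  shows "n \<le> card S"
proof -
  interpret fs: vector_space "\<lambda>(c::complex) (f :: 's \<Rightarrow> complex) x. c * f x"
    by unfold_locales (auto simp: fun_eq_iff algebra_simps)
  \<comment> \<open>Cutting off outside \<open>S\<close> places the vectors in the span of the
    indicator functions \<open>e y\<close> for \<open>y\<close> in \<open>S\<close>, without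
    changing any of the sums.\<close>
  define u where "u k x = (if x \<in> S then v k x else 0)" for k x
  define e where "e y x = (if x = y then 1 else 0 :: complex)" for x y :: 's
  have "f \<in> fs.span (e ` S)" if f: "\<And>x. x \<notin> S \<Longrightarrow> f x = 0" for f
  proof -
    have eq: "f = (\<Sum>y\<in>S. (\<lambda>x. f y * e y x))"
    proof
      fix x
      have "(\<Sum>y\<in>S. (\<lambda>x. f y * e y x)) x = (\<Sum>y\<in>S. f y * e y x)"
        using S by (induction S rule: finite_induct) auto
      also have "\<dots> = (\<Sum>y\<in>S. if y = x then f x else 0)"
        by (intro sum.cong) (auto simp: e_def)
      also have "\<dots> = f x" using f S by simp
      finally show "f x = (\<Sum>y\<in>S. (\<lambda>x. f y * e y x)) x" ..
    qed
    have "(\<Sum>y\<in>S. (\<lambda>x. f y * e y x)) \<in> fs.span (e ` S)"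
      by (intro fs.span_sum fs.span_scale fs.span_base imageI)
    then show ?thesis by (simp only: eq[symmetric])
  qed
  then have span: "u k \<in> fs.span (e ` S)" for k
    by (simp add: u_def)
  have "fs.independent (u ` {..<m}) \<and> card (u ` {..<m}) = m" if "m \<le> n" for m
    using that
  proof (induction m)
    case 0
    then show ?case by (simp add: fs.independent_empty)
  next
    case (Suc m)
    let ?K = "{f. (\<Sum>x\<in>S. g m x * f x) = 0}"
    have "fs.subspace ?K"
    proof (rule fs.subspaceI)
      show "(\<lambda>x. c * f x) \<in> ?K" if "f \<in> ?K" for c f
        using that by (simp add: mult.left_commute[of _ c] flip: sum_distrib_left)
    qed (simp_all add: distrib_left sum.distrib)
    moreover have "u ` {..<m} \<subseteq> ?K"
      using lower[of _ m] Suc.prems by (auto simp: u_def)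
    ultimately have "fs.span (u ` {..<m}) \<subseteq> ?K"
      by (rule fs.span_minimal[rotated])
    moreover have "u m \<notin> ?K"
      using diag[of m] Suc.prems by (auto simp: u_def)
    ultimately have notin: "u m \<notin> fs.span (u ` {..<m})" by blast
    then have "u m \<notin> u ` {..<m}" using fs.span_base[of "u m" "u ` {..<m}"] by argo
    with notin Suc show ?case
      by (simp add: lessThan_Suc fs.independent_insertI)
  qed
  then have ind: "fs.independent (u ` {..<n})" and card: "card (u ` {..<n}) = n" by auto
  have "card (u ` {..<n}) \<le> card (e ` S)"
    using fs.independent_span_bound[of "e ` S", OF _ ind] S span by auto
  then show ?thesis
    using card card_image_le[OF S, of e] by simp
qed

text \<open>The functional is pulled back by the transposed matrices, last letter first. The new
  coefficients do not depend on the starting state.\<close>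

lemma fold_linear_functional:
  fixes M :: "'a \<Rightarrow> 'i \<Rightarrow> 'i \<Rightarrow> complex"
  shows "\<exists>q'. \<forall>s. (\<Sum>c\<in>I. q c * fold (\<lambda>a s r. \<Sum>c\<in>I. M a r c * s c) w s c) = (\<Sum>c\<in>I. q' c * s c)"
proof (induction w arbitrary: q)
  case Nil
  then show ?case by auto
next
  case (Cons a w)
  let ?step = "\<lambda>a s r. \<Sum>c\<in>I. M a r c * s c"
  obtain q1 where q1: "\<And>s. (\<Sum>c\<in>I. q c * fold ?step w s c) = (\<Sum>c\<in>I. q1 c * s c)"
    using Cons by blast
  have "(\<Sum>r\<in>I. q1 r * ?step a s r) = (\<Sum>c\<in>I. (\<Sum>r\<in>I. q1 r * M a r c) * s c)" for s
    unfolding sum_distrib_left sum_distrib_right by (subst sum.swap) (simp add: mult.assoc)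
  then show ?case
    using q1 by (intro exI[of _ "\<lambda>c. \<Sum>r\<in>I. q1 r * M a r c"]) simp
qed

text \<open>The abstract form of the bound: \<open>good\<close> is a union of \<open>n\<close>
  subspaces, the \<open>p\<close>-th being the common kernel of the functionals
  \<open>Q p r\<close>. All trajectories start at the same vector and each letter acts
  linearly.\<close>

lemma short_words_suffice:
  fixes M :: "'a \<Rightarrow> 'i \<Rightarrow> 'i \<Rightarrow> complex" and Q :: "nat \<Rightarrow> 'r \<Rightarrow> 'i \<Rightarrow> complex"
    and s\<^sub>0 :: "'i \<Rightarrow> complex" and I :: "'i set" and R :: "'r set" and n :: nat
  defines "step \<equiv> \<lambda>a s r. \<Sum>c\<in>I. M a r c * s c"
  defines "good \<equiv> \<lambda>s. \<exists>p<n. \<forall>r\<in>R. (\<Sum>c\<in>I. Q p r c * s c) = 0"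
  assumes I: "finite I"
    and short: "\<And>w. w \<in> lists L \<Longrightarrow> length w \<le> card I ^ n \<Longrightarrow> good (fold step w s\<^sub>0)"
    and w: "w \<in> lists L"
  shows "good (fold step w s\<^sub>0)"
proof (rule ccontr)
  assume "\<not> good (fold step w s\<^sub>0)"
  then obtain w where w: "w \<in> lists L" and bad: "\<not> good (fold step w s\<^sub>0)"
    and least: "\<And>w'. w' \<in> lists L \<Longrightarrow> \<not> good (fold step w' s\<^sub>0) \<Longrightarrow> length w \<le> length w'"
    using ex_has_least_nat[of "\<lambda>w. w \<in> lists L \<and> \<not> good (fold step w s\<^sub>0)" w length] w by blast
  define s where "s k = fold step (take k w) s\<^sub>0" for k
  \<comment> \<open>\<open>T k\<close> is the \<open>n\<close>-th tensor power of the state after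
    \<open>k\<close> letters; its coordinates are indexed by the \<open>n\<close>-tuples
    \<open>S\<close> over \<open>I\<close>.\<close>
  define S where "S = PiE {..<n} (\<lambda>_. I)"
  define T where "T k f = (\<Prod>p<n. s k (f p))" for k f
  have "\<exists>g. (\<Sum>f\<in>S. g f * T k f) \<noteq> 0 \<and> (\<forall>j<k. (\<Sum>f\<in>S. g f * T j f) = 0)"
    if k: "k < Suc (length w)" for k
  proof -
    have "fold step (drop k w) (s k) = fold step w s\<^sub>0"
      unfolding s_def by (metis append_take_drop_id comp_apply fold_append)
    \<comment> \<open>The final state is bad, so each of the \<open>n\<close> subspaces has an
      equation \<open>r p\<close> that fails there.\<close>
    then obtain r where r: "\<And>p. p < n \<Longrightarrow> r p \<in> R \<and> (\<Sum>c\<in>I. Q p (r p) c * fold step (drop k w) (s k) c) \<noteq> 0"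
      using bad unfolding good_def by metis
    have "\<exists>q'. \<forall>s. (\<Sum>c\<in>I. Q p (r p) c * fold step (drop k w) s c) = (\<Sum>c\<in>I. q' c * s c)" for p
      unfolding step_def by (rule fold_linear_functional)
    then obtain q where q: "\<And>p s. (\<Sum>c\<in>I. Q p (r p) c * fold step (drop k w) s c) = (\<Sum>c\<in>I. q p c * s c)"
      by metis
    \<comment> \<open>Expanding the product of sums: a product of functionals, applied to a tensor
      power, is the product of the individual values.\<close>
    have sum: "(\<Sum>f\<in>S. (\<Prod>p<n. q p (f p)) * T j f)
        = (\<Prod>p<n. \<Sum>c\<in>I. Q p (r p) c * fold step (drop k w) (s j) c)" for j
      unfolding q T_def S_def by (subst prod_sum_PiE) (auto simp: I prod.distrib)
    have "(\<Sum>f\<in>S. (\<Prod>p<n. q p (f p)) * T k f) \<noteq> 0"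
      unfolding sum using r by simp
    moreover have "(\<Sum>f\<in>S. (\<Prod>p<n. q p (f p)) * T j f) = 0" if "j < k" for j
    proof -
      \<comment> \<open>Cutting out the letters between prefixes \<open>j\<close> and
        \<open>k\<close> gives a shorter word, which is good by minimality. The subspace it
        satisfies makes one factor of the product zero.\<close>
      let ?w = "take j w @ drop k w"
      have "?w \<in> lists L" using w by (auto dest: in_set_takeD in_set_dropD)
      moreover have "length ?w < length w" using that k by simp
      ultimately have "good (fold step ?w s\<^sub>0)" using least[of ?w] by linarith
      then have "good (fold step (drop k w) (s j))" by (simp add: s_def)
      then show ?thesis
        unfolding sum good_def using r by (auto simp: prod_zero_iff)
    qed
    ultimately show ?thesis by (intro exI[of _ "\<lambda>f. \<Prod>p<n. q p (f p)"]) blast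
  qed
  then have "\<exists>g. \<forall>k. k < Suc (length w) \<longrightarrow>
      (\<Sum>f\<in>S. g k f * T k f) \<noteq> 0 \<and> (\<forall>j<k. (\<Sum>f\<in>S. g k f * T j f) = 0)"
    by (intro choice) blast
  then obtain g where "\<And>k. k < Suc (length w) \<Longrightarrow> (\<Sum>f\<in>S. g k f * T k f) \<noteq> 0"
      "\<And>j k. j < k \<Longrightarrow> k < Suc (length w) \<Longrightarrow> (\<Sum>f\<in>S. g k f * T j f) = 0"
    by blast
  moreover have "finite S" "card S = card I ^ n"
    using I by (auto simp: S_def card_PiE intro: finite_PiE)
  \<comment> \<open>There is one tensor power per prefix, including the empty one, so
    \<open>w\<close> is strictly shorter than the bound and \<open>short\<close> applies to
    it.\<close>
  ultimately have "Suc (length w) \<le> card I ^ n"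
    using triangular_system_card_bound[of S "Suc (length w)" g T] by simp
  then show False using short[OF w] bad by simp
qed

section \<open>Supports of positive matrices\<close>

text \<open>
  The numerical range of a positive matrix is real, and on a Jordan chain of length two it would
  contain non-real values.
\<close>

lemma positive_no_jordan_chain:
  assumes A: "positive d A" and v: "v \<in> carrier_vec d" and w: "w \<in> carrier_vec d"
    and Av: "A *\<^sub>v v = e \<cdot>\<^sub>v v + w" and Aw: "A *\<^sub>v w = e \<cdot>\<^sub>v w"
  shows "w = 0\<^sub>v d"
proof (rule ccontr)
  assume "w \<noteq> 0\<^sub>v d"
  then have N0: "w \<bullet>c w \<noteq> 0" using w by simp
  have carr: "A \<in> carrier_mat d d" and real: "\<And>v. v \<in> carrier_vec d \<Longrightarrow> Im ((A *\<^sub>v v) \<bullet>c v) = 0"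
    using A by (auto simp: positive_def less_eq_complex_def)
  have sq: "Im (x \<bullet>c x) = 0" if "x \<in> carrier_vec d" for x :: "complex vec"
    using conjugate_square_ge_0_vec[of x] that by (auto simp: less_eq_complex_def)
  have "(A *\<^sub>v w) \<bullet>c w = e * (w \<bullet>c w)"
    using w by (simp add: Aw)
  then have "Im e = 0"
    using real[OF w] sq[OF w] N0 by (auto simp: complex_eq_iff)
  \<comment> \<open>With \<open>e\<close> real, the form at \<open>v + t w\<close> is real only if
    its cross term is. The shift \<open>t\<close> is free: \<open>0\<close> and \<i> together force
    the real part of the square of \<open>w\<close> to vanish.\<close>
  have "Im (w \<bullet>c v + cnj t * (w \<bullet>c w)) = 0" for t
  proof -
    let ?u = "v + t \<cdot>\<^sub>v w"
    have u: "?u \<in> carrier_vec d" using v w by simp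
    have "A *\<^sub>v ?u = e \<cdot>\<^sub>v ?u + w"
      using v w carr
      by (intro eq_vecI) (auto simp: mult_add_distrib_mat_vec[of _ d d] mult_mat_vec[of _ d d] Av Aw algebra_simps)
    then have "(A *\<^sub>v ?u) \<bullet>c ?u = e * (?u \<bullet>c ?u) + w \<bullet>c ?u"
      using u w by (simp add: add_scalar_prod_distrib[of _ d])
    also have "w \<bullet>c ?u = w \<bullet>c v + cnj t * (w \<bullet>c w)"
      using v w by (simp add: conjugate_add_vec[of _ d] conjugate_smult_vec scalar_prod_add_distrib[of _ d])
    finally show ?thesis
      using real[OF u] sq[OF u] \<open>Im e = 0\<close> by simp
  qed
  from this[of 0] this[of \<i>] have "Re (w \<bullet>c w) = 0" by simp
  with sq[OF w] N0 show False by (simp add: complex_eq_iff)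
qed

text \<open>The sum of all eigenspaces. In contrast to \<open>eigenvector\<close>, the summand may
  be the zero vector, which makes closure under scaling immediate; the eigenvalue may be 0 as
  well.\<close>

inductive_set eigensums :: "nat \<Rightarrow> complex mat \<Rightarrow> complex vec set" for d A where
  zero: "0\<^sub>v d \<in> eigensums d A"
| add: "v \<in> eigensums d A \<Longrightarrow> u \<in> carrier_vec d \<Longrightarrow> A *\<^sub>v u = e \<cdot>\<^sub>v u \<Longrightarrow> v + u \<in> eigensums d A"

lemma eigensums_carrier: "v \<in> eigensums d A \<Longrightarrow> v \<in> carrier_vec d"
  by (induction rule: eigensums.induct) auto

lemma eigensums_plus:
  assumes "v \<in> eigensums d A" and "w \<in> eigensums d A"
  shows "v + w \<in> eigensums d A"
  using assms(2)
proof (induction rule: eigensums.induct)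
  case zero
  then show ?case using assms eigensums_carrier by (simp add: right_zero_vec[of _ d])
next
  case (add w u e)
  then have "v + (w + u) = (v + w) + u"
    using assms(1) eigensums_carrier by (intro assoc_add_vec[symmetric, of _ d]) auto
  with add show ?case by (auto intro: eigensums.add)
qed

lemma eigensums_smult:
  assumes "A \<in> carrier_mat d d" and "v \<in> eigensums d A"
  shows "c \<cdot>\<^sub>v v \<in> eigensums d A"
  using assms(2)
proof (induction rule: eigensums.induct)
  case zero
  have "c \<cdot>\<^sub>v 0\<^sub>v d = (0\<^sub>v d :: complex vec)" by auto
  then show ?case by (simp add: eigensums.zero)
next
  case (add v u e)
  have "c \<cdot>\<^sub>v (v + u) = c \<cdot>\<^sub>v v + c \<cdot>\<^sub>v u"
    using add eigensums_carrier by (intro smult_add_distrib_vec[of _ d]) auto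
  moreover have "A *\<^sub>v (c \<cdot>\<^sub>v u) = e \<cdot>\<^sub>v (c \<cdot>\<^sub>v u)"
    using add assms(1) by (simp add: mult_mat_vec[of _ d d] smult_smult_assoc mult.commute)
  ultimately show ?case using add by (auto intro!: eigensums.add)
qed

text \<open>Up to an element \<open>w'\<close> of the eigenspace of \<open>e\<close>,
  \<open>w\<close> is the image of some \<open>x\<close> under \<open>A - e\<close>. A summand
  \<open>u\<close> with eigenvalue \<open>f \<noteq> e\<close> is the image of
  \<open>u / (f - e)\<close>; those with eigenvalue \<open>e\<close> are collected in
  \<open>w'\<close>.\<close>

lemma eigensums_split:
  assumes A: "A \<in> carrier_mat d d" and "w \<in> eigensums d A"
  shows "\<exists>x \<in> eigensums d A. \<exists>w'\<in>carrier_vec d. A *\<^sub>v w' = e \<cdot>\<^sub>v w' \<and> A *\<^sub>v x + w' = e \<cdot>\<^sub>v x + w"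
  using assms(2)
proof (induction rule: eigensums.induct)
  case zero
  have "A *\<^sub>v 0\<^sub>v d = 0\<^sub>v d" using A by (intro eq_vecI) auto
  moreover have "e \<cdot>\<^sub>v 0\<^sub>v d = (0\<^sub>v d :: complex vec)" by auto
  ultimately show ?case
    by (intro bexI[of _ "0\<^sub>v d"]) (auto intro: eigensums.zero)
next
  case (add w u f)
  then obtain x w' where x: "x \<in> eigensums d A" "w' \<in> carrier_vec d" "A *\<^sub>v w' = e \<cdot>\<^sub>v w'"
      "A *\<^sub>v x + w' = e \<cdot>\<^sub>v x + w" by blast
  have carr: "x \<in> carrier_vec d" "w \<in> carrier_vec d" "u \<in> carrier_vec d"
    using x add eigensums_carrier by auto
  have idx: "(A *\<^sub>v x) $ i + w' $ i = e * x $ i + w $ i" if "i < d" for i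
    using arg_cong[OF x(4), of "\<lambda>v. v $ i"] that carr x(2) A by simp
  show ?case
  proof (cases "f = e")
    case True
    have "A *\<^sub>v (w' + u) = e \<cdot>\<^sub>v (w' + u)"
      using carr x A add True
      by (simp add: mult_add_distrib_mat_vec[of _ d d] smult_add_distrib_vec[of _ d])
    moreover have "A *\<^sub>v x + (w' + u) = e \<cdot>\<^sub>v x + (w + u)"
      using carr x(2) A idx by (intro eq_vecI) (auto simp flip: add.assoc)
    ultimately show ?thesis
      using x carr by (intro bexI[of _ x] bexI[of _ "w' + u"] conjI) auto
  next
    case False
    define y where "y = x + (1 / (f - e)) \<cdot>\<^sub>v u"
    have Au: "A *\<^sub>v ((1 / (f - e)) \<cdot>\<^sub>v u) = f \<cdot>\<^sub>v ((1 / (f - e)) \<cdot>\<^sub>v u)"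
      using add A by (simp add: mult_mat_vec[of _ d d] smult_smult_assoc mult.commute)
    then have "y \<in> eigensums d A"
      unfolding y_def using x carr by (auto intro!: eigensums.add)
    moreover have "A *\<^sub>v y + w' = e \<cdot>\<^sub>v y + (w + u)"
    proof (rule eq_vecI)
      fix i assume "i < dim_vec (e \<cdot>\<^sub>v y + (w + u))"
      then have i: "i < d" using carr by simp
      have "f * (1 / (f - e) * u $ i) = e * (1 / (f - e) * u $ i) + u $ i"
        using False by (simp add: field_simps)
      then show "(A *\<^sub>v y + w') $ i = (e \<cdot>\<^sub>v y + (w + u)) $ i"
        using idx[OF i] i carr A x(2) unfolding y_def
        by (simp add: mult_add_distrib_mat_vec[of _ d d] Au algebra_simps del: index_mult_mat_vec)
    qed (use carr A x(2) in auto)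
    ultimately show ?thesis using x by auto
  qed
qed

text \<open>After subtracting the \<open>x\<close> of \<open>eigensums_split\<close>,
  \<open>A - e\<close> maps \<open>v - x\<close> into the eigenspace of \<open>e\<close>. That would
  be a Jordan chain of length two unless \<open>w'\<close> is zero, so \<open>v - x\<close> lies in
  the eigenspace.\<close>

lemma eigensums_if_shift:
  assumes A: "positive d A" and v: "v \<in> carrier_vec d"
    and w: "w \<in> eigensums d A" and Av: "A *\<^sub>v v = e \<cdot>\<^sub>v v + w"
  shows "v \<in> eigensums d A"
proof -
  have carr: "A \<in> carrier_mat d d" using A by (simp add: positive_def)
  obtain x w' where x: "x \<in> eigensums d A" "w' \<in> carrier_vec d" "A *\<^sub>v w' = e \<cdot>\<^sub>v w'"
      "A *\<^sub>v x + w' = e \<cdot>\<^sub>v x + w"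
    using eigensums_split[OF carr w] by blast
  have x': "x \<in> carrier_vec d" and w': "w \<in> carrier_vec d" using x(1) w eigensums_carrier by auto
  have "(A *\<^sub>v x) $ i + w' $ i = e * x $ i + w $ i" if "i < d" for i
    using arg_cong[OF x(4), of "\<lambda>v. v $ i"] that carr x(2) x' w' by simp
  moreover have "(A *\<^sub>v v) $ i = e * v $ i + w $ i" if "i < d" for i
    using arg_cong[OF Av, of "\<lambda>v. v $ i"] that carr v w' by simp
  ultimately have *: "A *\<^sub>v (v - x) = e \<cdot>\<^sub>v (v - x) + w'"
    using carr v x' x(2) w'
    by (intro eq_vecI) (auto simp: mult_minus_distrib_mat_vec[of _ d d] algebra_simps simp del: index_mult_mat_vec)
  then have "w' = 0\<^sub>v d"
    using x v x' by (intro positive_no_jordan_chain[OF A _ _ *]) auto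
  then have "A *\<^sub>v (v - x) = e \<cdot>\<^sub>v (v - x)" using * v x' by simp
  then have "x + (v - x) \<in> eigensums d A"
    using x v x' by (intro eigensums.add) auto
  moreover have "x + (v - x) = v" using v x' by auto
  ultimately show ?thesis by simp
qed

lemma eigensums_sum:
  fixes m :: nat
  assumes A: "A \<in> carrier_mat d d" and "\<forall>k<m. p k \<in> eigensums d A"
  shows "vec d (\<lambda>i. \<Sum>k<m. c k * p k $ i) \<in> eigensums d A"
  using assms(2)
proof (induction m)
  case 0
  have "vec d (\<lambda>i. \<Sum>k<0. c k * p k $ i) = 0\<^sub>v d" by auto
  then show ?case by (simp add: eigensums.zero)
next
  case (Suc m)
  have "p m \<in> carrier_vec d" using Suc.prems eigensums_carrier by blast
  then have "vec d (\<lambda>i. \<Sum>k<Suc m. c k * p k $ i) = vec d (\<lambda>i. \<Sum>k<m. c k * p k $ i) + c m \<cdot>\<^sub>v p m"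
    by auto
  then show ?case
    using Suc by (simp add: eigensums_plus eigensums_smult[OF A])
qed

text \<open>In a Schur decomposition, \<open>A\<close> maps column \<open>j\<close> of
  \<open>P\<close> to a multiple of itself plus a combination of earlier columns. By induction these
  are sums of eigenvectors, and \<open>eigensums_if_shift\<close> passes this on to column
  \<open>j\<close>.\<close>

lemma positive_eigenbasis:
  assumes A: "positive d A"
  obtains P Q where "P \<in> carrier_mat d d" "Q \<in> carrier_mat d d" "P * Q = 1\<^sub>m d"
    and "\<And>j. j < d \<Longrightarrow> col P j \<in> eigensums d A"
proof -
  have carr: "A \<in> carrier_mat d d" using A by (simp add: positive_def)
  obtain es where "char_poly A = (\<Prod>a\<leftarrow>es. [:- a, 1:])"
    using char_poly_factorized[OF carr] by blast
  moreover obtain B P Q where "schur_decomposition A es = (B, P, Q)"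
    by (rule prod_cases3)
  ultimately have sim: "similar_mat_wit A B P Q" and up: "upper_triangular B"
    using schur_decomposition[OF carr] by blast+
  note S = similar_mat_witD2[OF carr sim]
  have AP: "A * P = P * B"
  proof -
    have "A * P = P * B * (Q * P)"
      using S(5-7) by (subst S(3)) (simp add: assoc_mult_mat[of _ d d _ d _ d])
    then show ?thesis using S(2,5,6) by simp
  qed
  have "col P j \<in> eigensums d A" if "j < d" for j
    using that
  proof (induction j rule: less_induct)
    case (less j)
    let ?w = "vec d (\<lambda>i. \<Sum>k<j. B $$ (k, j) * col P k $ i)"
    have "?w \<in> eigensums d A"
      using less by (intro eigensums_sum[OF carr]) auto
    moreover have "col P j \<in> carrier_vec d" using S(6) by (rule col_carrier_vec[OF less.prems])
    moreover have "A *\<^sub>v col P j = B $$ (j, j) \<cdot>\<^sub>v col P j + ?w"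
    proof (rule eq_vecI)
      fix i assume "i < dim_vec (B $$ (j, j) \<cdot>\<^sub>v col P j + ?w)"
      then have i: "i < d" by simp
      have "(A *\<^sub>v col P j) $ i = (A * P) $$ (i, j)"
        using i less.prems S carr by simp
      also have "\<dots> = (\<Sum>k<d. P $$ (i, k) * B $$ (k, j))"
        unfolding AP using i less.prems S
        by (simp add: scalar_prod_def atLeast0LessThan)
      also have "\<dots> = (\<Sum>k<Suc j. P $$ (i, k) * B $$ (k, j))"
        using less.prems up S by (intro sum.mono_neutral_right) (auto simp: upper_triangular_def)
      also have "\<dots> = (B $$ (j, j) \<cdot>\<^sub>v col P j + ?w) $ i"
        using i less.prems S by (simp add: mult.commute)
      finally show "(A *\<^sub>v col P j) $ i = (B $$ (j, j) \<cdot>\<^sub>v col P j + ?w) $ i" .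
    qed (use carr in simp)
    ultimately show ?case
      using eigensums_if_shift[OF A] by blast
  qed
  then show thesis using that S by blast
qed

text \<open>If the support lies in \<open>p\<close>, then \<open>P * \<sigma>\<close> and \<sigma>
  agree on eigenvectors, hence on the columns of an invertible matrix; here positivity enters.
  Conversely, \<open>P * \<sigma> = \<sigma>\<close> makes \<open>P\<close> fix every eigenvector
  for a nonzero eigenvalue.\<close>

lemma supp_subset_iff:
  assumes \<sigma>: "positive d \<sigma>" and P: "projector_onto d P p" and p: "is_subspace d p"
  shows "supp \<sigma> \<subseteq> p \<longleftrightarrow> P * \<sigma> = \<sigma>"
proof -
  interpret V: vec_space "TYPE(complex)" d .
  let ?E = "{v. \<exists>e. e \<noteq> 0 \<and> eigenvector \<sigma> v e}"
  have carr: "\<sigma> \<in> carrier_mat d d" using \<sigma> by (simp add: positive_def)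
  have Pc: "P \<in> carrier_mat d d" and PP: "P * P = P" and p_eq: "p = (\<lambda>v. P *\<^sub>v v) ` carrier_vec d"
    using P by (auto simp: projector_onto_def)
  have supp: "supp \<sigma> = V.span ?E"
    using carr by (simp add: supp_def)
  have E: "?E \<subseteq> carrier_vec d" using carr by (auto simp: eigenvector_def)
  show ?thesis
  proof
    assume sub: "supp \<sigma> \<subseteq> p"
    have fix1: "P *\<^sub>v v = v" if "e \<noteq> 0" "eigenvector \<sigma> v e" for v e
    proof -
      have "v \<in> p" using sub that V.in_own_span[of ?E] E unfolding supp by auto
      then obtain u where "u \<in> carrier_vec d" "v = P *\<^sub>v u" using p_eq by blast
      then show ?thesis using Pc PP by (simp flip: assoc_mult_mat_vec[of _ d d _ d])
    qed
    \<comment> \<open>Eigenvectors for eigenvalue 0 are outside the reach of \<open>fix1\<close>,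
      but \<sigma> sends them to zero, so the claim is about images under \<sigma>.\<close>
    have fix2: "P *\<^sub>v (\<sigma> *\<^sub>v v) = \<sigma> *\<^sub>v v" if "v \<in> eigensums d \<sigma>" for v
      using that
    proof (induction rule: eigensums.induct)
      case zero
      have "M *\<^sub>v 0\<^sub>v d = 0\<^sub>v d" if "M \<in> carrier_mat d d" for M :: "complex mat"
        using that by (intro eq_vecI) auto
      then show ?case using carr Pc by simp
    next
      case (add v u e)
      have "P *\<^sub>v (e \<cdot>\<^sub>v u) = e \<cdot>\<^sub>v u"
      proof (cases "e = 0 \<or> u = 0\<^sub>v d")
        case True
        then have "e \<cdot>\<^sub>v u = 0\<^sub>v d" using add by auto
        moreover have "P *\<^sub>v 0\<^sub>v d = 0\<^sub>v d" using Pc by (intro eq_vecI) auto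
        ultimately show ?thesis by simp
      next
        case False
        then have "P *\<^sub>v u = u" using fix1[of e u] add carr by (auto simp: eigenvector_def)
        then show ?thesis using Pc add by (simp add: mult_mat_vec[of _ d d])
      qed
      then show ?case
        using add carr Pc eigensums_carrier[of v d \<sigma>]
        by (simp add: mult_add_distrib_mat_vec[of _ d d])
    qed
    obtain U W where U: "U \<in> carrier_mat d d" "W \<in> carrier_mat d d" "U * W = 1\<^sub>m d"
      and cols: "\<And>j. j < d \<Longrightarrow> col U j \<in> eigensums d \<sigma>"
      using positive_eigenbasis[OF \<sigma>] by blast
    have "P * \<sigma> * U = \<sigma> * U"
    proof (rule eq_matI)
      fix i j assume "i < dim_row (\<sigma> * U)" "j < dim_col (\<sigma> * U)"
      then have ij: "i < d" "j < d" using carr U by auto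
      have "(P * \<sigma> * U) $$ (i, j) = (P * \<sigma> *\<^sub>v col U j) $ i"
        using ij carr U Pc
        by (metis carrier_matD index_mult_mat(1) index_mult_mat_vec mult_carrier_mat)
      also have "P * \<sigma> *\<^sub>v col U j = \<sigma> *\<^sub>v col U j"
        using fix2[OF cols[OF ij(2)]] carr U Pc ij by (subst assoc_mult_mat_vec[of _ d d _ d]) auto
      also have "\<dots> $ i = (\<sigma> * U) $$ (i, j)"
        using ij carr U by simp
      finally show "(P * \<sigma> * U) $$ (i, j) = (\<sigma> * U) $$ (i, j)" .
    qed (use carr U Pc in auto)
    then have "P * \<sigma> * U * W = \<sigma> * U * W" by simp
    then show "P * \<sigma> = \<sigma>"
      using carr U Pc by (simp add: assoc_mult_mat[of _ d d _ d _ d])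
  next
    assume fixed: "P * \<sigma> = \<sigma>"
    have "?E \<subseteq> p"
    proof
      fix v assume "v \<in> ?E"
      then obtain e where e: "e \<noteq> 0" "eigenvector \<sigma> v e" by blast
      then have v: "v \<in> carrier_vec d" "\<sigma> *\<^sub>v v = e \<cdot>\<^sub>v v" using carr by (auto simp: eigenvector_def)
      have "P *\<^sub>v (e \<cdot>\<^sub>v v) = e \<cdot>\<^sub>v v"
        using fixed v carr Pc by (metis assoc_mult_mat_vec)
      then have "P *\<^sub>v ((1 / e) \<cdot>\<^sub>v (e \<cdot>\<^sub>v v)) = (1 / e) \<cdot>\<^sub>v (e \<cdot>\<^sub>v v)"
        using v Pc by (subst mult_mat_vec[of _ d d]) auto
      then have "P *\<^sub>v v = v" using e by (simp add: smult_smult_assoc)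
      then show "v \<in> p" unfolding p_eq using v by (metis imageI)
    qed
    moreover have "submodule class_ring p (module_vec TYPE(complex) d)"
      using p by (simp add: is_subspace_def subspace_def)
    ultimately show "supp \<sigma> \<subseteq> p"
      unfolding supp by (rule V.span_is_subset)
  qed
qed

section \<open>Super-operators in coordinates\<close>

lemma superop_entry:
  assumes E: "linear_superop d E" and X: "X \<in> carrier_mat d d" and r: "r < d * d"
  shows "E X $$ (r div d, r mod d) =
    (\<Sum>c<d * d. superop_mat d E $$ (r, c) * X $$ (c div d, c mod d))"
proof -
  have E_carrier: "\<And>A. A \<in> carrier_mat d d \<Longrightarrow> E A \<in> carrier_mat d d"
    and E_add: "\<And>A B. A \<in> carrier_mat d d \<Longrightarrow> B \<in> carrier_mat d d \<Longrightarrow> E (A + B) = E A + E B"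
    and E_smult: "\<And>c A. A \<in> carrier_mat d d \<Longrightarrow> E (c \<cdot>\<^sub>m A) = c \<cdot>\<^sub>m E A"
    using E by (auto simp: linear_superop_def)
  have d: "d > 0" using r by (cases d) auto
  then have rd: "r div d < d" "r mod d < d" using r by (auto simp: less_mult_imp_div_less)
  \<comment> \<open>\<open>Y m\<close> keeps the first \<open>m\<close> entries of \<open>X\<close>
    in row-major order, so that each induction step adds a multiple of one matrix unit.\<close>
  define Y where "Y m = mat d d (\<lambda>(i, j). if i * d + j < m then X $$ (i, j) else 0)" for m
  let ?U = "\<lambda>m. matrix_unit d (m div d) (m mod d)"
  have Y: "Y m \<in> carrier_mat d d" and U: "?U m \<in> carrier_mat d d" for m
    by (auto simp: Y_def matrix_unit_def)
  have "E (Y m) $$ (r div d, r mod d) =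
      (\<Sum>c<m. superop_mat d E $$ (r, c) * X $$ (c div d, c mod d))" if "m \<le> d * d" for m
    using that
  proof (induction m)
    case 0
    \<comment> \<open>That \<open>E\<close> maps zero to zero is obtained from homogeneity with the
      scalar 0.\<close>
    have "Y 0 = 0 \<cdot>\<^sub>m Y 0" by (auto simp: Y_def)
    then have "E (Y 0) = 0 \<cdot>\<^sub>m E (Y 0)" using E_smult[OF Y, of 0 0] by simp
    then have "E (Y 0) $$ (r div d, r mod d) = (0 \<cdot>\<^sub>m E (Y 0)) $$ (r div d, r mod d)" by simp
    also have "\<dots> = 0" using E_carrier[OF Y, of 0] rd by simp
    finally show ?case by simp
  next
    case (Suc m)
    have eq: "i * d + j = m \<longleftrightarrow> i = m div d \<and> j = m mod d" if "j < d" for i j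
      using that by auto
    have "Y (Suc m) = Y m + X $$ (m div d, m mod d) \<cdot>\<^sub>m ?U m"
      by (rule eq_matI) (auto simp: Y_def matrix_unit_def less_Suc_eq eq)
    then have "E (Y (Suc m)) = E (Y m) + X $$ (m div d, m mod d) \<cdot>\<^sub>m E (?U m)"
      using E_add[OF Y, of "_ \<cdot>\<^sub>m ?U m" m] E_smult[OF U] U by simp
    then have "E (Y (Suc m)) $$ (r div d, r mod d) =
        E (Y m) $$ (r div d, r mod d) + X $$ (m div d, m mod d) * E (?U m) $$ (r div d, r mod d)"
      using E_carrier[OF Y, of m] E_carrier[OF U, of m] rd by simp
    then show ?case
      using Suc r by (simp add: superop_mat_def mult.commute)
  qed
  moreover have "Y (d * d) = X"
  proof (rule eq_matI)
    fix i j assume "i < dim_row X" "j < dim_col X"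
    then have ij: "i < d" "j < d" using X by auto
    then have "i * d + j < Suc i * d" by simp
    also have "\<dots> \<le> d * d" using ij by (intro mult_le_mono1) simp
    finally show "Y (d * d) $$ (i, j) = X $$ (i, j)" using ij by (simp add: Y_def)
  qed (use X in \<open>auto simp: Y_def\<close>)
  ultimately show ?thesis by force
qed

text \<open>Complete positivity at \<open>k = 1\<close>, where the ampliation has a single
  block.\<close>

lemma tp_superoperator_positive:
  assumes E: "tp_superoperator d E" and X: "positive d X"
  shows "positive d (E X)"
proof -
  have Xc: "X \<in> carrier_mat d d" using X by (simp add: positive_def)
  then have EX: "E X \<in> carrier_mat d d"
    using E by (auto simp: tp_superoperator_def linear_superop_def)
  have "block d X 0 0 = X" using Xc by (auto simp: block_def)
  then have "ampliation 1 d E X = E X"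
    using EX by (auto simp: ampliation_def)
  moreover have "positive (1 * d) (ampliation 1 d E X)"
    using E X unfolding tp_superoperator_def completely_positive_def by (metis mult_1)
  ultimately show ?thesis by simp
qed

lemma fold_superop_positive:
  assumes "quantum_automaton A" and "u \<in> lists (Act A)"
  shows "positive (hdim A) (fold (superop A) u (init A))"
  using assms(2)
proof (induction u rule: rev_induct)
  case Nil
  then show ?case using assms(1) by (simp add: quantum_automaton_def density_def)
next
  case (snoc a u)
  then show ?case
    using assms(1) by (auto simp: quantum_automaton_def intro: tp_superoperator_positive)
qed

lemma admissible_eq_fold: "admissible A w k = fold (superop A) (map w [0..<k]) (init A)"
  by (induction k) auto

text \<open>Only prefixes matter. A finite word is extended to an infinite one by repeating some
  letter, which is why \<open>Act A\<close> must be nonempty.\<close>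

lemma box_valid_iff_words:
  assumes "Act A \<noteq> {}"
  shows "box_valid A ps \<longleftrightarrow> (\<forall>u\<in>lists (Act A). sat_union (fold (superop A) u (init A)) ps)"
proof
  assume box: "box_valid A ps"
  obtain a where a: "a \<in> Act A" using assms by blast
  show "\<forall>u\<in>lists (Act A). sat_union (fold (superop A) u (init A)) ps"
  proof
    fix u assume u: "u \<in> lists (Act A)"
    define w where "w k = (if k < length u then u ! k else a)" for k
    have "w k \<in> Act A" for k using u a by (auto simp: w_def)
    then have "sat_union (admissible A w (length u)) ps" using box by (simp add: box_valid_def)
    moreover have "map w [0..<length u] = u" by (rule nth_equalityI) (auto simp: w_def)
    ultimately show "sat_union (fold (superop A) u (init A)) ps" by (simp add: admissible_eq_fold)
  qed
next
  assume words: "\<forall>u\<in>lists (Act A). sat_union (fold (superop A) u (init A)) ps"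
  have "map w [0..<k] \<in> lists (Act A)" if "\<forall>k. w k \<in> Act A" for w k
    using that by auto
  with words show "box_valid A ps"
    unfolding box_valid_def admissible_eq_fold by blast
qed

lemma sat_union_iff:
  assumes "positive d \<sigma>" and "list_all2 (projector_onto d) Ps ps" and "\<forall>p\<in>set ps. is_subspace d p"
  shows "sat_union \<sigma> ps \<longleftrightarrow> (\<exists>i<length Ps. Ps ! i * \<sigma> = \<sigma>)"
proof -
  have len: "length Ps = length ps" using assms(2) by (rule list_all2_lengthD)
  have "supp \<sigma> \<subseteq> ps ! i \<longleftrightarrow> Ps ! i * \<sigma> = \<sigma>" if "i < length Ps" for i
    using that len assms by (intro supp_subset_iff[of d]) (auto simp: list_all2_nthD)
  moreover have "(\<exists>p\<in>set ps. supp \<sigma> \<subseteq> p) \<longleftrightarrow> (\<exists>i<length Ps. supp \<sigma> \<subseteq> ps ! i)"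
    unfolding len by (metis in_set_conv_nth)
  ultimately show ?thesis
    by (auto simp: sat_union_def sat_subspace_def)
qed

lemma sum_lessThan_mult:
  fixes f :: "nat \<Rightarrow> 'b::comm_monoid_add"
  shows "(\<Sum>c<m * d. f c) = (\<Sum>k<m. \<Sum>l<d. f (k * d + l))"
proof -
  have "sum f {k * d..<k * d + d} = (\<Sum>l<d. f (k * d + l))" for k
    using sum.atLeastLessThan_shift_0[of f "k * d" "k * d + d"] by (simp add: atLeast0LessThan)
  then show ?thesis
    by (simp flip: sum.nat_group)
qed

lemma less_mult_add: "i < m \<Longrightarrow> j < d \<Longrightarrow> i * d + j < m * (d::nat)"
  by (metis add_less_cancel_left less_le_trans mult_Suc add.commute Suc_leI mult_le_mono1)

lemma mult_mat_fixed_iff: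
  assumes P: "P \<in> carrier_mat d d" and \<sigma>: "\<sigma> \<in> carrier_mat d d"
  shows "P * \<sigma> = \<sigma> \<longleftrightarrow> (\<forall>i<d. \<forall>j<d. (\<Sum>k<d. P $$ (i, k) * \<sigma> $$ (k, j)) = \<sigma> $$ (i, j))"
proof -
  have "(P * \<sigma>) $$ (i, j) = (\<Sum>k<d. P $$ (i, k) * \<sigma> $$ (k, j))" if "i < d" "j < d" for i j
    using that assms by (simp add: scalar_prod_def atLeast0LessThan)
  moreover have "P * \<sigma> = \<sigma> \<longleftrightarrow> (\<forall>i<d. \<forall>j<d. (P * \<sigma>) $$ (i, j) = \<sigma> $$ (i, j))"
    using assms by (auto simp: mat_eq_iff)
  ultimately show ?thesis by simp
qed

lemma short_words_suffice_automaton: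
  assumes A: "quantum_automaton A" and Ps: "set Ps \<subseteq> carrier_mat (hdim A) (hdim A)"
    and short: "\<And>u. u \<in> lists (Act A) \<Longrightarrow> length u \<le> (hdim A * hdim A) ^ length Ps \<Longrightarrow>
      \<exists>i<length Ps. Ps ! i * fold (superop A) u (init A) = fold (superop A) u (init A)"
    and u: "u \<in> lists (Act A)"
  shows "\<exists>i<length Ps. Ps ! i * fold (superop A) u (init A) = fold (superop A) u (init A)"
proof -
  let ?d = "hdim A"
  define I where "I = {..<?d * ?d}"
  define M where "M a r c = superop_mat ?d (superop A a) $$ (r, c)" for a r c
  \<comment> \<open>Row \<open>r\<close> of the matrix of the map sending \<open>X\<close> to
    \<open>P * X - X\<close> on row-major vectors, where \<open>P\<close> is \<open>Ps ! p\<close>: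
    left multiplication mixes only entries in the same column of \<open>X\<close>.\<close>
  define Q where "Q p r c = (if c mod ?d = r mod ?d then Ps ! p $$ (r div ?d, c div ?d) else 0)
    - (if c = r then 1 else 0)" for p r c
  define step where "step a s r = (\<Sum>c\<in>I. M a r c * s c)" for a r and s :: "nat \<Rightarrow> complex"
  define s where "s u = fold step u (\<lambda>c. init A $$ (c div ?d, c mod ?d))" for u
  let ?\<sigma> = "\<lambda>u. fold (superop A) u (init A)"
  have \<sigma>: "?\<sigma> u \<in> carrier_mat ?d ?d" if "u \<in> lists (Act A)" for u
    using fold_superop_positive[OF A that] by (simp add: positive_def)
  \<comment> \<open>Agreement is claimed only on \<open>I\<close>: beyond it the coordinates do not
    correspond to matrix entries.\<close>
  have s: "\<forall>r\<in>I. s u r = ?\<sigma> u $$ (r div ?d, r mod ?d)" if "u \<in> lists (Act A)" for u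
    using that
  proof (induction u rule: rev_induct)
    case Nil
    then show ?case by (simp add: s_def)
  next
    case (snoc a u)
    have lin: "linear_superop ?d (superop A a)"
      using A snoc.prems by (auto simp: quantum_automaton_def tp_superoperator_def)
    show ?case
    proof
      fix r assume "r \<in> I"
      then have r: "r < ?d * ?d" by (simp add: I_def)
      have "s (u @ [a]) r = (\<Sum>c\<in>I. M a r c * s u c)"
        by (simp add: s_def step_def)
      also have "\<dots> = (\<Sum>c\<in>I. M a r c * ?\<sigma> u $$ (c div ?d, c mod ?d))"
        using snoc by (intro sum.cong) auto
      also have "\<dots> = ?\<sigma> (u @ [a]) $$ (r div ?d, r mod ?d)"
        using superop_entry[OF lin \<sigma> r, of u] snoc.prems by (simp add: M_def I_def)
      finally show "s (u @ [a]) r = ?\<sigma> (u @ [a]) $$ (r div ?d, r mod ?d)" .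
    qed
  qed
  have good: "(\<forall>r\<in>I. (\<Sum>c\<in>I. Q p r c * s u c) = 0) \<longleftrightarrow> Ps ! p * ?\<sigma> u = ?\<sigma> u"
    if u: "u \<in> lists (Act A)" and p: "p < length Ps" for u p
  proof -
    have "(\<Sum>c\<in>I. Q p (i * ?d + j) c * s u c) =
        (\<Sum>k<?d. Ps ! p $$ (i, k) * ?\<sigma> u $$ (k, j)) - ?\<sigma> u $$ (i, j)" if ij: "i < ?d" "j < ?d" for i j
    proof -
      have r: "i * ?d + j \<in> I" using ij by (simp add: I_def less_mult_add)
      have "(\<Sum>c\<in>I. Q p (i * ?d + j) c * s u c) =
          (\<Sum>c\<in>I. (if c mod ?d = j then Ps ! p $$ (i, c div ?d) * ?\<sigma> u $$ (c div ?d, j) else 0)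
            - (if c = i * ?d + j then ?\<sigma> u $$ (i, j) else 0))"
        using ij s[OF u] by (intro sum.cong) (auto simp: Q_def left_diff_distrib)
      also have "\<dots> = (\<Sum>c\<in>I. if c mod ?d = j then Ps ! p $$ (i, c div ?d) * ?\<sigma> u $$ (c div ?d, j) else 0)
          - ?\<sigma> u $$ (i, j)"
        using r by (simp add: sum_subtractf I_def)
      \<comment> \<open>Writing \<open>c\<close> as \<open>k * d + l\<close> turns the condition on
        \<open>c mod d\<close> into \<open>l = j\<close>.\<close>
      also have "(\<Sum>c\<in>I. if c mod ?d = j then Ps ! p $$ (i, c div ?d) * ?\<sigma> u $$ (c div ?d, j) else 0)
          = (\<Sum>k<?d. \<Sum>l<?d. if l = j then Ps ! p $$ (i, k) * ?\<sigma> u $$ (k, j) else 0)"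
        unfolding I_def sum_lessThan_mult by (intro sum.cong) auto
      also have "\<dots> = (\<Sum>k<?d. Ps ! p $$ (i, k) * ?\<sigma> u $$ (k, j))"
        using ij by simp
      finally show ?thesis .
    qed
    moreover have "(\<forall>r\<in>I. (\<Sum>c\<in>I. Q p r c * s u c) = 0) \<longleftrightarrow>
        (\<forall>i<?d. \<forall>j<?d. (\<Sum>c\<in>I. Q p (i * ?d + j) c * s u c) = 0)"
    proof (intro iffI ballI allI impI)
      fix r assume "\<forall>i<?d. \<forall>j<?d. (\<Sum>c\<in>I. Q p (i * ?d + j) c * s u c) = 0" and "r \<in> I"
      moreover from \<open>r \<in> I\<close> have "r div ?d < ?d" "r mod ?d < ?d"
        by (cases "?d = 0"; simp add: I_def less_mult_imp_div_less)+
      ultimately have "(\<Sum>c\<in>I. Q p (r div ?d * ?d + r mod ?d) c * s u c) = 0" by blast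
      then show "(\<Sum>c\<in>I. Q p r c * s u c) = 0" by (simp only: div_mult_mod_eq)
    next
      fix i j assume "\<forall>r\<in>I. (\<Sum>c\<in>I. Q p r c * s u c) = 0" and "i < ?d" "j < ?d"
      then show "(\<Sum>c\<in>I. Q p (i * ?d + j) c * s u c) = 0" by (simp add: I_def less_mult_add)
    qed
    moreover have "Ps ! p \<in> carrier_mat ?d ?d" using Ps p nth_mem by blast
    note mult_mat_fixed_iff[OF this \<sigma>[OF u]]
    ultimately show ?thesis by simp
  qed
  have "\<exists>p<length Ps. \<forall>r\<in>I. (\<Sum>c\<in>I. Q p r c * s u c) = 0"
    unfolding s_def step_def
  proof (rule short_words_suffice[OF _ _ u])
    show "finite I" by (simp add: I_def)
    fix w assume "w \<in> lists (Act A)" and "length w \<le> card I ^ length Ps"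
    then show "\<exists>p<length Ps. \<forall>r\<in>I. (\<Sum>c\<in>I. Q p r c *
        fold (\<lambda>a s r. \<Sum>c\<in>I. M a r c * s c) w (\<lambda>c. init A $$ (c div ?d, c mod ?d)) c) = 0"
      using short[of w] good[of w, unfolded s_def step_def] by (auto simp: I_def)
  qed
  then show ?thesis using good[OF u] by blast
qed

section \<open>Correctness of the decision procedure\<close>

definition gmat_of :: "(rat \<times> rat) mat \<Rightarrow> gmat"
  where "gmat_of M = map (map (\<lambda>q. gnum_of_code (code_of_gauss_rat q))) (mat_to_list M)"

definition represents :: "nat \<Rightarrow> gnum list \<Rightarrow> complex mat \<Rightarrow> bool"
  where "represents d v \<sigma> \<longleftrightarrow>
    (\<forall>c<d * d. gval (nth_default gzero v c) = \<sigma> $$ (c div d, c mod d))"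

lemma gval_gentry_gmat_of:
  assumes "i < dim_row M" and "j < dim_col M"
  shows "gval (gentry (gmat_of M) i j) = map_mat gauss_rat M $$ (i, j)"
  using assms by (simp add: gentry_def gmat_of_def nth_default_def mat_to_list_def gval_gnum_of_code)

lemma concat_rows:
  "length (concat (map (\<lambda>i. map (f i) [0..<d]) [0..<m])) = m * d"
  "c < m * d \<Longrightarrow> concat (map (\<lambda>i. map (f i) [0..<d]) [0..<m]) ! c = f (c div d) (c mod d)"
proof (induction m)
  case (Suc m)
  {
    case 1
    then show ?case using Suc(1) by simp
  next
    case 2
    show ?case
    proof (cases "c < m * d")
      case True
      then show ?thesis using Suc by (simp add: nth_append)
    next
      case False
      define l where "l = c - m * d"
      then have "c = m * d + l" "l < d" using False 2 by auto
      then show ?thesis using Suc(1) by (simp add: nth_append)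
    qed
  }
qed simp_all

lemma represents_concat_gmat_of:
  assumes "M \<in> carrier_mat d d"
  shows "represents d (concat (gmat_of M)) (map_mat gauss_rat M)"
proof -
  have eq: "gmat_of M = map (\<lambda>i. map (\<lambda>j. gnum_of_code (code_of_gauss_rat (M $$ (i, j)))) [0..<d]) [0..<d]"
    using assms by (simp add: gmat_of_def mat_to_list_def comp_def)
  show ?thesis
    unfolding represents_def
  proof (intro allI impI)
    fix c assume c: "c < d * d"
    then have "c div d < d" "c mod d < d"
      by (cases "d = 0"; simp add: less_mult_imp_div_less)+
    then show "gval (nth_default gzero (concat (gmat_of M)) c) = map_mat gauss_rat M $$ (c div d, c mod d)"
      using c assms unfolding eq nth_default_def
      by (simp only: concat_rows) (simp add: gval_gnum_of_code)
  qed
qed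

lemma represents_gstep:
  assumes "represents d v \<sigma>" and \<sigma>: "\<sigma> \<in> carrier_mat d d" and E: "linear_superop d E"
    and M: "map_mat gauss_rat M = superop_mat d E"
  shows "represents d (gstep d (gmat_of M) v) (E \<sigma>)"
  unfolding represents_def
proof (intro allI impI)
  fix r assume r: "r < d * d"
  have dim: "dim_row M = d * d" "dim_col M = d * d"
    using arg_cong[OF M, of dim_row] arg_cong[OF M, of dim_col] by (auto simp: superop_mat_def)
  have "gval (nth_default gzero (gstep d (gmat_of M) v) r) =
      (\<Sum>c<d * d. gval (gentry (gmat_of M) r c) * gval (nth_default gzero v c))"
    using r by (simp add: gstep_def nth_default_nth gval_gsum gval_gmult)
  also have "\<dots> = (\<Sum>c<d * d. superop_mat d E $$ (r, c) * \<sigma> $$ (c div d, c mod d))"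
    using r assms(1) dim by (intro sum.cong) (auto simp: gval_gentry_gmat_of M represents_def)
  also have "\<dots> = E \<sigma> $$ (r div d, r mod d)"
    using superop_entry[OF E \<sigma> r] by simp
  finally show "gval (nth_default gzero (gstep d (gmat_of M) v) r) = E \<sigma> $$ (r div d, r mod d)" .
qed

lemma gfixed_iff:
  assumes v: "represents d v \<sigma>" and \<sigma>: "\<sigma> \<in> carrier_mat d d"
    and P: "map_mat gauss_rat P \<in> carrier_mat d d"
  shows "gfixed d (gmat_of P) v \<longleftrightarrow> map_mat gauss_rat P * \<sigma> = \<sigma>"
proof -
  have v': "gval (nth_default gzero v (i * d + j)) = \<sigma> $$ (i, j)" if "i < d" "j < d" for i j
    using v less_mult_add[OF that] that by (auto simp: represents_def)
  have "gval (gsum (\<lambda>k. gmult (gentry (gmat_of P) i k) (nth_default gzero v (k * d + j))) d)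
      = (\<Sum>k<d. map_mat gauss_rat P $$ (i, k) * \<sigma> $$ (k, j))" if "i < d" "j < d" for i j
    unfolding gval_gsum gval_gmult
  proof (intro sum.cong refl)
    fix k assume "k \<in> {..<d}"
    then show "gval (gentry (gmat_of P) i k) * gval (nth_default gzero v (k * d + j)) =
        map_mat gauss_rat P $$ (i, k) * \<sigma> $$ (k, j)"
      using that P by (subst gval_gentry_gmat_of) (auto simp: v')
  qed
  then show ?thesis
    unfolding mult_mat_fixed_iff[OF P \<sigma>] gfixed_def geq_iff by (simp add: v')
qed

text \<open>Words of matrices and words of letters are linked by a relation, since distinct letters
  may have the same matrix.\<close>

lemma represents_fold:
  assumes A: "quantum_automaton A" and init: "represents (hdim A) v (init A)"
    and w: "list_all2 (\<lambda>M a. a \<in> Act A \<and> map_mat gauss_rat M = superop_mat (hdim A) (superop A a)) w u"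
  shows "represents (hdim A) (fold (gstep (hdim A)) (map gmat_of w) v) (fold (superop A) u (init A))"
  using w
proof (induction u arbitrary: w rule: rev_induct)
  case Nil
  then show ?case using init by simp
next
  case (snoc a u)
  then obtain w' M where w': "w = w' @ [M]"
      "list_all2 (\<lambda>M a. a \<in> Act A \<and> map_mat gauss_rat M = superop_mat (hdim A) (superop A a)) w' u"
      "a \<in> Act A" "map_mat gauss_rat M = superop_mat (hdim A) (superop A a)"
    by (auto simp: list_all2_append2 list_all2_Cons2)
  have "u \<in> lists (Act A)"
    using w'(2) by (auto simp: list_all2_conv_all_nth in_set_conv_nth)
  then have "fold (superop A) u (init A) \<in> carrier_mat (hdim A) (hdim A)"
    using fold_superop_positive[OF A] by (auto simp: positive_def)
  moreover have "linear_superop (hdim A) (superop A a)"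
    using A w'(3) by (auto simp: quantum_automaton_def tp_superoperator_def)
  ultimately show ?case
    using snoc.IH[OF w'(2)] w'(1,4) represents_gstep by auto
qed

lemma decide_code_iff_box_valid:
  assumes A: "quantum_automaton A" and Act: "Act A \<noteq> {}"
    and ps: "\<forall>p\<in>set ps. is_subspace (hdim A) p" and c: "presents c A ps"
  shows "decide_code (data_codes c) \<longleftrightarrow> box_valid A ps"
proof -
  let ?d = "hdim A"
  let ?Ps = "map (map_mat gauss_rat) (rprojs c)"
  let ?v = "concat (gmat_of (rinit c))"
  let ?R = "\<lambda>M a. a \<in> Act A \<and> map_mat gauss_rat M = superop_mat ?d (superop A a)"
  obtain as where as: "set as = Act A"
      "map (map_mat gauss_rat) (rsuperops c) = map (\<lambda>\<alpha>. superop_mat ?d (superop A \<alpha>)) as"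
    using c by (auto simp: presents_def)
  have dim: "rdim c = ?d" and init: "map_mat gauss_rat (rinit c) = init A"
    and proj: "list_all2 (projector_onto ?d) ?Ps ps"
    using c by (auto simp: presents_def)
  have Ps: "set ?Ps \<subseteq> carrier_mat ?d ?d"
    using proj by (auto simp: list_all2_conv_all_nth in_set_conv_nth projector_onto_def)
  have "init A \<in> carrier_mat ?d ?d"
    using A by (simp add: quantum_automaton_def density_def positive_def)
  then have "rinit c \<in> carrier_mat ?d ?d" by (simp flip: init)
  then have v: "represents ?d ?v (init A)"
    using represents_concat_gmat_of init by metis
  have R1: "\<exists>a. ?R M a" if "M \<in> set (rsuperops c)" for M
  proof -
    have "map_mat gauss_rat M \<in> set (map (\<lambda>\<alpha>. superop_mat ?d (superop A \<alpha>)) as)"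
      unfolding as(2)[symmetric] using that by simp
    then show ?thesis using as(1) by auto
  qed
  have R2: "\<exists>M\<in>set (rsuperops c). ?R M a" if "a \<in> Act A" for a
  proof -
    have "superop_mat ?d (superop A a) \<in> set (map (map_mat gauss_rat) (rsuperops c))"
      unfolding as(2) using that as(1) by simp
    then show ?thesis using that by auto
  qed
  have good: "(\<exists>P\<in>set (map gmat_of (rprojs c)). gfixed ?d P (fold (gstep ?d) (map gmat_of w) ?v)) \<longleftrightarrow>
      (\<exists>i<length ?Ps. ?Ps ! i * fold (superop A) u (init A) = fold (superop A) u (init A))"
    if "list_all2 ?R w u" and u: "u \<in> lists (Act A)" for w u
  proof -
    have "fold (superop A) u (init A) \<in> carrier_mat ?d ?d"
      using fold_superop_positive[OF A u] by (simp add: positive_def)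
    then have "gfixed ?d (gmat_of P) (fold (gstep ?d) (map gmat_of w) ?v) \<longleftrightarrow>
        map_mat gauss_rat P * fold (superop A) u (init A) = fold (superop A) u (init A)"
      if "P \<in> set (rprojs c)" for P
      using gfixed_iff[OF represents_fold[OF A v \<open>list_all2 ?R w u\<close>]] Ps that by auto
    then show ?thesis
      by (simp add: Bex_set_list_ex list_ex_length cong: conj_cong)
  qed
  have "decide_code (data_codes c) \<longleftrightarrow>
      decide ?d (map gmat_of (rsuperops c)) (gmat_of (rinit c)) (map gmat_of (rprojs c))"
    by (simp add: decide_code_def data_codes_def dim gmat_of_def[abs_def] comp_def)
  also have "\<dots> \<longleftrightarrow> (\<forall>w\<in>lists (set (rsuperops c)). length w \<le> (?d * ?d) ^ length ?Ps \<longrightarrow>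
      (\<exists>P\<in>set (map gmat_of (rprojs c)). gfixed ?d P (fold (gstep ?d) (map gmat_of w) ?v)))"
    unfolding decide_iff set_map lists_image length_map by simp
  also have "\<dots> \<longleftrightarrow> (\<forall>u\<in>lists (Act A). length u \<le> (?d * ?d) ^ length ?Ps \<longrightarrow>
      (\<exists>i<length ?Ps. ?Ps ! i * fold (superop A) u (init A) = fold (superop A) u (init A)))"
    (is "?W \<longleftrightarrow> ?U")
  proof (intro iffI ballI impI)
    fix u assume W: ?W and u: "u \<in> lists (Act A)" and len: "length u \<le> (?d * ?d) ^ length ?Ps"
    \<comment> \<open>One matrix is chosen for every letter, to translate words letter by letter;
      the other direction chooses a letter for every matrix.\<close>
    obtain F where F: "\<And>a. a \<in> Act A \<Longrightarrow> F a \<in> set (rsuperops c) \<and> ?R (F a) a"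
      using R2 by metis
    have "list_all2 ?R (map F u) u"
      using u F by (auto simp: list_all2_conv_all_nth)
    note good = good[OF this u]
    have "map F u \<in> lists (set (rsuperops c))" using u F by auto
    moreover have "length (map F u) \<le> (?d * ?d) ^ length ?Ps" using len by simp
    ultimately show "\<exists>i<length ?Ps. ?Ps ! i * fold (superop A) u (init A) = fold (superop A) u (init A)"
      using W good by blast
  next
    fix w assume U: ?U and w: "w \<in> lists (set (rsuperops c))" and len: "length w \<le> (?d * ?d) ^ length ?Ps"
    obtain F where F: "\<And>M. M \<in> set (rsuperops c) \<Longrightarrow> ?R M (F M)"
      using R1 by metis
    have "list_all2 ?R w (map F w)"
      using w F by (auto simp: list_all2_conv_all_nth)
    moreover have u: "map F w \<in> lists (Act A)" using w F by auto
    ultimately have "(\<exists>P\<in>set (map gmat_of (rprojs c)). gfixed ?d P (fold (gstep ?d) (map gmat_of w) ?v)) \<longleftrightarrow>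
      (\<exists>i<length ?Ps. ?Ps ! i * fold (superop A) (map F w) (init A) = fold (superop A) (map F w) (init A))"
      by (rule good)
    moreover have "length (map F w) \<le> (?d * ?d) ^ length ?Ps" using len by simp
    ultimately show "\<exists>P\<in>set (map gmat_of (rprojs c)). gfixed ?d P (fold (gstep ?d) (map gmat_of w) ?v)"
      using U u by blast
  qed
  also have "\<dots> \<longleftrightarrow> (\<forall>u\<in>lists (Act A).
      \<exists>i<length ?Ps. ?Ps ! i * fold (superop A) u (init A) = fold (superop A) u (init A))"
    using short_words_suffice_automaton[OF A Ps] by blast
  also have "\<dots> \<longleftrightarrow> (\<forall>u\<in>lists (Act A). sat_union (fold (superop A) u (init A)) ps)"
    using sat_union_iff[OF fold_superop_positive[OF A] proj ps] by blast
  also have "\<dots> \<longleftrightarrow> box_valid A ps"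
    using box_valid_iff_words[OF Act] by blast
  finally show ?thesis .
qed

theorem theorem9:
  shows "\<exists>f. partial_recursive 1 f \<and>
    (\<forall>(A :: 'a quantum_automaton) (ps :: complex vec set list) (c :: rational_data).
      quantum_automaton A \<longrightarrow> card (Act A) > 1 \<longrightarrow>
      (\<forall>p\<in>set ps. is_subspace (hdim A) p) \<longrightarrow>
      presents c A ps \<longrightarrow>
      f [encode_data c] = Some (if box_valid A ps then 1 else 0))"
proof -
  obtain f where f: "partial_recursive 1 f"
      "\<And>c. f [encode_data c] = Some (if decide_code (data_codes c) then 1 else 0)"
    using partial_recursive_decide by blast
  have "f [encode_data c] = Some (if box_valid A ps then 1 else 0)"
    if "quantum_automaton A" "card (Act A) > 1" "\<forall>p\<in>set ps. is_subspace (hdim A) p" "presents c A ps"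
    for A :: "'a quantum_automaton" and ps c
  proof -
    have "Act A \<noteq> {}" using that(2) by auto
    then show ?thesis using decide_code_iff_box_valid[OF that(1) _ that(3,4)] f(2) by simp
  qed
  with f(1) show ?thesis by blast
qed

end
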